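(* Let $M$ be a complete metric space with a designated origin $0$. Then the following assertions are equivalent: (i) $\mathcal{F}(M)$ does not have any strongly exposed point; (ii) $\mathcal{F}(M)$ has the convex DLD2P; (iii) $\mathcal{F}(M,X)$ has the convex DLD2P for every nontrivial Banach space $X$.
   Context: All Banach spaces are real and nontrivial (i.e. $\neq\{0\}$); in particular $\mathcal{F}(M)\neq\{0\}$, i.e. $M$ has at least two points. $B_Z$, $S_Z$, $Z^\ast$ denote the closed unit ball, the unit sphere and the dual space of a Banach space $Z$. Let $M$ be a metric space with metric $d$ and designated origin $0\in M$, and let $X$ be a Banach space. $\mathrm{Lip}_0(M,X)$ is the Banach space of all Lipschitz functions $f\colon M\to X$ with $f(0)=0$, with norm $\|f\|=\sup\{\|f(x)-f(y)\|/d(x,y): x,y\in M,\ x\ne y\}$. For $m\in M$ and $x\in X$, let $\delta_{m,x}\in \mathrm{Lip}_0(M,X^\ast)^\ast$ be the functional $\delta_{m,x}(f)=f(m)(x)$. The vector-valued Lipschitz-free space is $\mathcal{F}(M,X)=\overline{\mathrm{span}}\{\delta_{m,x}: m\in M,\ x\in X\}\subset \mathrm{Lip}_0(M,X^\ast)^\ast$ (norm closure), and $\mathcal{F}(M)=\mathcal{F}(M,\mathbb{R})$. A strongly exposed point of a Banach space $Z$ means a strongly exposed point of its unit ball $B_Z$: a point $z\in B_Z$ for which there is $z^\ast\in Z^\ast$ with $z^\ast(z)=\sup_{w\in B_Z}z^\ast(w)$ and such that $z_n\to z$ in norm whenever $(z_n)\subset B_Z$ and $z^\ast(z_n)\to z^\ast(z)$.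 For $z\in S_Z$ and $\varepsilon>0$ let $\Delta^Z_\varepsilon(z)=\{w\in B_Z:\|z-w\|\ge 2-\varepsilon\}$. A point $z\in S_Z$ is a $\Delta$-point of $Z$ if $z\in\overline{\mathrm{conv}}\,\Delta^Z_\varepsilon(z)$ (norm-closed convex hull) for every $\varepsilon>0$; $\Delta_Z$ denotes the set of all $\Delta$-points of $Z$. $Z$ has the convex diametral local diameter two property (convex DLD2P) if $B_Z=\overline{\mathrm{conv}}\,\Delta_Z$. *)

theory Defs
  imports "HOL-Analysis.Analysis" "HOL-Library.Function_Algebras"
begin

instantiation "fun" :: (type, real_vector) real_vector
begin

definition scaleR_fun :: "real \<Rightarrow> ('a \<Rightarrow> 'b) \<Rightarrow> 'a \<Rightarrow> 'b"
  where "scaleR_fun c f = (\<lambda>x. c *\<^sub>R f x)"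

instance
  by standard (simp_all add: scaleR_fun_def plus_fun_def fun_eq_iff algebra_simps)

end

text \<open>
  A normed space is given by a linear subspace of an ambient real vector space together with a
  norm on it. Values of the norm outside the carrier are irrelevant. This representation lets
  Banach spaces be quantified over inside a formula, and lets the spaces of functions and
  functionals below depend on the base point of the metric space. Quantifying over all
  \<open>X :: 'x nspace\<close> with \<open>banach_space X\<close>, for a type variable \<open>'x :: real_vector\<close>, covers every
  Banach space: its vector space can be taken as \<open>'x\<close>, with carrier \<open>UNIV\<close>. If \<open>'x\<close> has a nonzero
  vector, the range of such a quantifier includes isometric copies of the real line.
\<close>

record 'a nspace =
  vecs :: "'a set"
  nrm :: "'a \<Rightarrow> real"

definition normed_space :: "'a::real_vector nspace \<Rightarrow> bool" where
  "normed_space Z \<longleftrightarrow>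
     subspace (vecs Z) \<and>
     (\<forall>x\<in>vecs Z. 0 \<le> nrm Z x \<and> (nrm Z x = 0 \<longleftrightarrow> x = 0)) \<and>
     (\<forall>x\<in>vecs Z. \<forall>c. nrm Z (c *\<^sub>R x) = \<bar>c\<bar> * nrm Z x) \<and>
     (\<forall>x\<in>vecs Z. \<forall>y\<in>vecs Z. nrm Z (x + y) \<le> nrm Z x + nrm Z y)"

definition banach_space :: "'a::real_vector nspace \<Rightarrow> bool" where
  "banach_space Z \<longleftrightarrow>
     normed_space Z \<and>
     (\<forall>s. (\<forall>n. s n \<in> vecs Z) \<and>
          (\<forall>e>0. \<exists>N. \<forall>m\<ge>N. \<forall>n\<ge>N. nrm Z (s m - s n) < e) \<longrightarrow>
          (\<exists>l\<in>vecs Z. (\<lambda>n. nrm Z (s n - l)) \<longlonglongrightarrow> 0))"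

definition nontrivial :: "'a::real_vector nspace \<Rightarrow> bool" where
  "nontrivial Z \<longleftrightarrow> vecs Z \<noteq> {0}"

definition space_of_type :: "'a::real_normed_vector nspace" where
  "space_of_type = \<lparr>vecs = UNIV, nrm = norm\<rparr>"

lemma banach_space_of_type: "banach_space (space_of_type :: 'a::banach nspace)"
proof -
  have "\<exists>l. (\<lambda>n. norm (s n - l)) \<longlonglongrightarrow> 0"
    if "\<forall>e>0. \<exists>N. \<forall>m\<ge>N. \<forall>n\<ge>N. norm (s m - s n) < e" for s :: "nat \<Rightarrow> 'a"
  proof -
    have "Cauchy s"
      using that by (simp add: Cauchy_def dist_norm)
    then obtain l where "s \<longlonglongrightarrow> l"
      by (meson Cauchy_convergent_iff convergent_def)
    then show ?thesis
      using LIM_zero tendsto_norm_zero by blast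
  qed
  then show ?thesis
    by (auto simp: banach_space_def normed_space_def space_of_type_def norm_triangle_ineq)
qed

definition unit_ball :: "'a nspace \<Rightarrow> 'a set" where
  "unit_ball Z = {z \<in> vecs Z. nrm Z z \<le> 1}"

definition unit_sphere :: "'a nspace \<Rightarrow> 'a set" where
  "unit_sphere Z = {z \<in> vecs Z. nrm Z z = 1}"

definition norm_closure :: "'a::real_vector nspace \<Rightarrow> 'a set \<Rightarrow> 'a set" where
  "norm_closure Z S = {z \<in> vecs Z. \<forall>e>0. \<exists>s\<in>S. nrm Z (z - s) < e}"

text \<open>
  A functional on the carrier of \<open>Z\<close> is represented by the function on the ambient type that
  vanishes outside the carrier, so that equal functionals are equal as HOL functions and the
  vector space operations are pointwise.
\<close>

definition dual :: "'a::real_vector nspace \<Rightarrow> ('a \<Rightarrow> real) nspace" where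
  "dual Z =
    \<lparr>vecs = {\<phi>. (\<forall>x\<in>vecs Z. \<forall>y\<in>vecs Z. \<phi> (x + y) = \<phi> x + \<phi> y) \<and>
                 (\<forall>x\<in>vecs Z. \<forall>c. \<phi> (c *\<^sub>R x) = c * \<phi> x) \<and>
                 (\<exists>C. \<forall>x\<in>vecs Z. \<bar>\<phi> x\<bar> \<le> C * nrm Z x) \<and>
                 (\<forall>x. x \<notin> vecs Z \<longrightarrow> \<phi> x = 0)},
     nrm = (\<lambda>\<phi>. SUP x\<in>unit_ball Z. \<bar>\<phi> x\<bar>)\<rparr>"

definition Lip0 :: "'m::metric_space \<Rightarrow> 'a::real_vector nspace \<Rightarrow> ('m \<Rightarrow> 'a) nspace" where
  "Lip0 p Z =
    \<lparr>vecs = {f. (\<forall>m. f m \<in> vecs Z) \<and> f p = 0 \<and>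
                 (\<exists>C. \<forall>x y. nrm Z (f x - f y) \<le> C * dist x y)},
     nrm = (\<lambda>f. Sup {nrm Z (f x - f y) / dist x y | x y. x \<noteq> y})\<rparr>"

definition delta ::
  "'m::metric_space \<Rightarrow> 'a::real_vector nspace \<Rightarrow> 'm \<Rightarrow> 'a \<Rightarrow> ('m \<Rightarrow> 'a \<Rightarrow> real) \<Rightarrow> real" where
  "delta p X m x = (\<lambda>f. if f \<in> vecs (Lip0 p (dual X)) then f m x else 0)"

definition free_space ::
  "'m::metric_space \<Rightarrow> 'a::real_vector nspace \<Rightarrow> (('m \<Rightarrow> 'a \<Rightarrow> real) \<Rightarrow> real) nspace" where
  "free_space p X =
    (let D = dual (Lip0 p (dual X)) in
     \<lparr>vecs = norm_closure D (span {delta p X m x | m x. x \<in> vecs X}),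
      nrm = nrm D\<rparr>)"

definition scalar_free_space :: "'m::metric_space \<Rightarrow> (('m \<Rightarrow> real \<Rightarrow> real) \<Rightarrow> real) nspace" where
  "scalar_free_space p = free_space p space_of_type"

definition strongly_exposed_point :: "'a::real_vector nspace \<Rightarrow> 'a \<Rightarrow> bool" where
  "strongly_exposed_point Z z \<longleftrightarrow>
     z \<in> unit_ball Z \<and>
     (\<exists>\<phi>\<in>vecs (dual Z).
        \<phi> z = (SUP w\<in>unit_ball Z. \<phi> w) \<and>
        (\<forall>s. (\<forall>n. s n \<in> unit_ball Z) \<and> (\<lambda>n. \<phi> (s n)) \<longlonglongrightarrow> \<phi> z \<longrightarrow>
             (\<lambda>n. nrm Z (s n - z)) \<longlonglongrightarrow> 0))"

definition far_set :: "'a::real_vector nspace \<Rightarrow> real \<Rightarrow> 'a \<Rightarrow> 'a set" where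
  "far_set Z \<epsilon> z = {w \<in> unit_ball Z. nrm Z (z - w) \<ge> 2 - \<epsilon>}"

definition Delta_points :: "'a::real_vector nspace \<Rightarrow> 'a set" where
  "Delta_points Z =
     {z \<in> unit_sphere Z. \<forall>\<epsilon>>0. z \<in> norm_closure Z (convex hull (far_set Z \<epsilon> z))}"

definition convex_DLD2P :: "'a::real_vector nspace \<Rightarrow> bool" where
  "convex_DLD2P Z \<longleftrightarrow> unit_ball Z = norm_closure Z (convex hull (Delta_points Z))"

end

theory Submission
  imports Defs
begin

text \<open>
  If \<open>\<F>(M)\<close> has no strongly exposed point, then every pair of distinct points of \<open>M\<close> has
  property (Z): for a pair without it, the molecule is strongly exposed by the average of two
  peaking functions. In a complete space, property (Z) of all pairs allows every pair to be joined
  by chains of arbitrarily small mesh and almost minimal length: a pair \<open>(u, v)\<close> that is maximal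
  for a Caristi-type order among those at distance at least half of \<open>d(x, y)\<close> yields, together with
  the point given by property (Z), a chain \<open>x, u, z, v, y\<close> whose steps are at most about half as
  long, and this is iterated. Along such a chain, a molecule \<open>m\<close> of \<open>\<F>(M, X)\<close> is almost a convex
  combination of molecules of short steps, which have distance almost two from \<open>m\<close>. So all
  molecules are \<open>\<Delta>\<close>-points, and their closed convex hull is the unit ball by the Hahn-Banach
  theorem. Conversely, small slices around a strongly exposed point contain no \<open>\<Delta>\<close>-point, and
  a one-dimensional \<open>X\<close> serves for the implication from (iii).
\<close>

subsection \<open>The Hahn-Banach theorem\<close>

text \<open>Property (Z) speaks of \<open>M\<close> alone, and this is what lets the assertions be
  compared although the free spaces over different \<open>X\<close> live on different types. The
  absence of strongly exposed points, in \<open>\<F>(M)\<close> or in \<open>\<F>(M, X)\<close> for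
  a one-dimensional \<open>X\<close>, yields (Z); and (Z) yields the convex DLD2P for all
  \<open>X\<close> at once. Accordingly a molecule whose pair fails (Z) is shown to be strongly
  exposed for every one-dimensional \<open>X\<close>, and no isometry between free spaces is
  constructed.

  The obstacle in building chains is that (Z) may only offer points very close to an endpoint, which
  cannot be iterated directly. A maximal pair removes it: the pair has been pushed inward as far as
  the half-distance threshold allows, so one more point from (Z) has to cross the threshold.
  Completeness of \<open>M\<close> enters through the existence of this maximal pair.\<close>

lemma sublinear_minimal_imp_linear:
  fixes q :: "'a::real_vector \<Rightarrow> real"
  assumes add: "\<And>x y. q (x + y) \<le> q x + q y"
    and hom: "\<And>c x. 0 < c \<Longrightarrow> q (c *\<^sub>R x) \<le> c * q x"
    and super: "\<And>x y. q x + q y \<le> q (x + y)"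
  shows "linear q"
proof -
  have add_eq: "q (x + y) = q x + q y" for x y
    using add super by (simp add: order_antisym)
  have q0: "q 0 = 0"
    using add_eq[of 0 0] by simp
  have neg: "q (- x) = - q x" for x
    using add_eq[of x "- x"] q0 by simp
  have pos: "q (c *\<^sub>R x) = c * q x" if "0 < c" for c x
  proof -
    have "q ((1/c) *\<^sub>R (c *\<^sub>R x)) \<le> (1/c) * q (c *\<^sub>R x)"
      using hom[of "1/c" "c *\<^sub>R x"] that by simp
    then have "c * q x \<le> q (c *\<^sub>R x)"
      using that by (simp add: field_simps)
    then show ?thesis
      using hom[OF that, of x] by simp
  qed
  have "q (c *\<^sub>R x) = c * q x" for c x
  proof (cases c "0::real" rule: linorder_cases)
    case less
    have "q (c *\<^sub>R x) = - q ((- c) *\<^sub>R x)"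
      using neg[of "(- c) *\<^sub>R x"] by simp
    then show ?thesis
      using pos[of "- c" x] less by simp
  qed (auto simp: q0 pos)
  then show ?thesis
    using add_eq by (auto intro!: linearI)
qed

text \<open>Homogeneity is asked as an inequality for positive factors: applied to \<open>c\<close>
  and to \<open>1 / c\<close> it gives the equality, and the factors 2 and 1/2 give
  \<open>q 0 = 0\<close>.\<close>

definition sublinear :: "('a::real_vector \<Rightarrow> real) \<Rightarrow> bool" where
  "sublinear q \<longleftrightarrow> (\<forall>x y. q (x + y) \<le> q x + q y) \<and> (\<forall>c x. 0 < c \<longrightarrow> q (c *\<^sub>R x) \<le> c * q x)"

lemma sublinear_zero:
  assumes "sublinear q"
  shows "q 0 = 0"
proof -
  have "q (c *\<^sub>R 0) \<le> c * q 0" if "0 < c" for c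
    using assms that unfolding sublinear_def by blast
  from this[of 2] this[of "1/2"] show ?thesis by simp
qed

text \<open>Lowers \<open>q\<close> towards linearity along \<open>y\<close>: the result is
  sublinear, lies below \<open>q\<close> (take \<open>t = 0\<close>), and is at most
  \<open>- q y\<close> at \<open>- y\<close> (take \<open>t = 1\<close>).\<close>

definition slide :: "('a::real_vector \<Rightarrow> real) \<Rightarrow> 'a \<Rightarrow> 'a \<Rightarrow> real" where
  "slide q y x = (INF t\<in>{0..}. q (x + t *\<^sub>R y) - t * q y)"

lemma
  assumes q: "sublinear q"
  shows slide_le: "0 \<le> t \<Longrightarrow> slide q y x \<le> q (x + t *\<^sub>R y) - t * q y"
    and sublinear_slide: "sublinear (slide q y)"
proof -
  have add: "q (u + v) \<le> q u + q v" for u v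
    using q by (simp add: sublinear_def)
  have hom: "q (c *\<^sub>R u) \<le> c * q u" if "0 < c" for c u
    using q that by (simp add: sublinear_def)
  have hom0: "q (c *\<^sub>R u) \<le> c * q u" if "0 \<le> c" for c u
    using hom[of c u] that sublinear_zero[OF q] by (cases "c = 0") auto
  have inv: "t * q y \<le> q (t *\<^sub>R y)" if "0 \<le> t" for t
  proof (cases "t = 0")
    case True
    then show ?thesis using sublinear_zero[OF q] by simp
  next
    case False
    then have "q ((1/t) *\<^sub>R (t *\<^sub>R y)) \<le> (1/t) * q (t *\<^sub>R y)"
      using hom[of "1/t" "t *\<^sub>R y"] that by simp
    then show ?thesis using False that by (simp add: field_simps)
  qed
  have bdd: "bdd_below ((\<lambda>t. q (x + t *\<^sub>R y) - t * q y) ` {0..})" for x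
  proof (rule bdd_belowI2[where m = "- q (- x)"])
    fix t :: real
    assume "t \<in> {0..}"
    then show "- q (- x) \<le> q (x + t *\<^sub>R y) - t * q y"
      using add[of "x + t *\<^sub>R y" "- x"] inv[of t] by simp
  qed
  show le: "slide q y x \<le> q (x + t *\<^sub>R y) - t * q y" if "0 \<le> t" for t x
    unfolding slide_def using bdd that by (intro cINF_lower) auto
  show "sublinear (slide q y)"
    unfolding sublinear_def
  proof (intro conjI allI impI)
    fix u v
    have "slide q y (u + v) \<le> (q (u + s *\<^sub>R y) - s * q y) + (q (v + t *\<^sub>R y) - t * q y)"
      if "0 \<le> s" "0 \<le> t" for s t
      using le[of "s + t" "u + v"] add[of "u + s *\<^sub>R y" "v + t *\<^sub>R y"] that
      by (simp add: algebra_simps)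
    then have "slide q y (u + v) - (q (u + s *\<^sub>R y) - s * q y) \<le> q (v + t *\<^sub>R y) - t * q y"
      if "0 \<le> s" "0 \<le> t" for s t
      using that by (simp add: diff_le_eq add.commute)
    then have "slide q y (u + v) - (q (u + s *\<^sub>R y) - s * q y) \<le> slide q y v" if "0 \<le> s" for s
      unfolding slide_def[of q y v] using that by (intro cINF_greatest) auto
    then have "slide q y (u + v) - slide q y v \<le> slide q y u"
      unfolding slide_def[of q y u] by (intro cINF_greatest) (auto simp: algebra_simps)
    then show "slide q y (u + v) \<le> slide q y u + slide q y v" by simp
  next
    fix c :: real and u
    assume c: "0 < c"
    have "slide q y (c *\<^sub>R u) / c \<le> q (u + t *\<^sub>R y) - t * q y" if "0 \<le> t" for t
      using le[of "c * t" "c *\<^sub>R u"] hom[OF c, of "u + t *\<^sub>R y"] that c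
      by (simp add: field_simps scaleR_add_right)
    then have "slide q y (c *\<^sub>R u) / c \<le> slide q y u"
      unfolding slide_def[of q y u] by (intro cINF_greatest) auto
    then show "slide q y (c *\<^sub>R u) \<le> c * slide q y u"
      using c by (simp add: field_simps)
  qed
qed

text \<open>A minimal sublinear functional \<open>m\<close> below \<open>q\<close> is linear:
  minimality forces \<open>slide m y = m\<close>, and the bound of the slide at \<open>t = 1\<close>
  is superadditivity. Zorn's lemma applies because the pointwise infimum of a chain is finite, by
  the lower bound \<open>- q (- x)\<close>.\<close>

lemma ex_linear_le_sublinear:
  fixes q :: "'a::real_vector \<Rightarrow> real"
  assumes q: "sublinear q"
  shows "\<exists>\<phi>. linear \<phi> \<and> (\<forall>x. \<phi> x \<le> q x)"
proof -
  let ?A = "{r. sublinear r \<and> (\<forall>x. r x \<le> q x)}"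
  \<comment> \<open>Reversed pointwise order, so that the maximal element from Zorn's lemma is a
    minimal functional.\<close>
  let ?P = "\<lambda>r s :: 'a \<Rightarrow> real. \<forall>x. s x \<le> r x"
  have low: "- q (- x) \<le> r x" if "r \<in> ?A" for r x
  proof -
    have "r (x + - x) \<le> r x + r (- x)" "r (- x) \<le> q (- x)"
      using that unfolding sublinear_def by blast+
    moreover have "r 0 = 0" using that sublinear_zero by blast
    ultimately show ?thesis by simp
  qed
  have "\<exists>m\<in>?A. \<forall>r\<in>?A. ?P m r \<longrightarrow> r = m"
  proof (rule predicate_Zorn)
    show "partial_order_on ?A (relation_of ?P ?A)"
    proof (rule partial_order_on_relation_ofI)
      fix r s t
      show "?P r r" by simp
      show "?P r s \<Longrightarrow> ?P s t \<Longrightarrow> ?P r t" by (auto intro: order_trans)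
      show "?P r s \<Longrightarrow> ?P s r \<Longrightarrow> r = s" by (intro ext order_antisym) blast+
    qed
  next
    fix C
    assume C: "C \<in> Chains (relation_of ?P ?A)"
    then have CA: "C \<subseteq> ?A"
      unfolding Chains_def relation_of_def by auto
    have tot: "?P r s \<or> ?P s r" if "r \<in> C" "s \<in> C" for r s
      using C that unfolding Chains_def relation_of_def by auto
    show "\<exists>u\<in>?A. \<forall>r\<in>C. ?P r u"
    proof (cases "C = {}")
      case True
      then show ?thesis using q by auto
    next
      case False
      define u where "u x = (INF r\<in>C. r x)" for x
      have bdd: "bdd_below ((\<lambda>r. r x) ` C)" for x
        using low CA by (intro bdd_belowI2[where m = "- q (- x)"]) auto
      have le: "u x \<le> r x" if "r \<in> C" for r x
        unfolding u_def using bdd that by (intro cINF_lower) auto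
      \<comment> \<open>Two members of the chain are comparable, so the smaller one serves both
        arguments.\<close>
      have "u (x + y) \<le> r x + s y" if rs: "r \<in> C" "s \<in> C" for r s x y
      proof -
        obtain t where t: "t \<in> C" "t x \<le> r x" "t y \<le> s y"
          using tot[OF rs] rs by auto
        then have "t (x + y) \<le> t x + t y"
          using CA unfolding sublinear_def by auto
        then show ?thesis using t le[of t "x + y"] by linarith
      qed
      then have "u (x + y) - r x \<le> s y" if "r \<in> C" "s \<in> C" for r s x y
        using that by (simp add: diff_le_eq add.commute)
      then have "u (x + y) - r x \<le> u y" if "r \<in> C" for r x y
        unfolding u_def[of y] using that False by (intro cINF_greatest) auto
      then have "u (x + y) - u y \<le> u x" for x y
        unfolding u_def[of x] using False by (intro cINF_greatest) (auto simp: algebra_simps)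
      then have add: "u (x + y) \<le> u x + u y" for x y
        by (simp add: algebra_simps)
      have "u (c *\<^sub>R x) / c \<le> u x" if c: "0 < c" for c x
        unfolding u_def[of x]
      proof (rule cINF_greatest[OF False])
        fix r
        assume r: "r \<in> C"
        then have "r (c *\<^sub>R x) \<le> c * r x"
          using CA c unfolding sublinear_def by auto
        then show "u (c *\<^sub>R x) / c \<le> r x"
          using le[OF r, of "c *\<^sub>R x"] c by (simp add: field_simps)
      qed
      then have "u (c *\<^sub>R x) \<le> c * u x" if "0 < c" for c x
        using that by (simp add: field_simps)
      with add have "sublinear u" by (simp add: sublinear_def)
      moreover have "u x \<le> q x" for x
      proof -
        obtain r where "r \<in> C" using False by auto
        then show ?thesis using le[of r x] CA by (auto intro: order_trans)
      qed
      ultimately show ?thesis using le by auto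
    qed
  qed
  then obtain m where m: "sublinear m" "\<And>x. m x \<le> q x"
    and min: "\<And>r. sublinear r \<Longrightarrow> (\<forall>x. r x \<le> m x) \<Longrightarrow> r = m"
    by (auto, meson order_trans)
  have "m x + m y \<le> m (x + y)" for x y
  proof -
    have "slide m y = m"
      using sublinear_slide[OF m(1)] slide_le[OF m(1), of 0] by (intro min) auto
    then show ?thesis
      using slide_le[OF m(1), of 1 y x] by simp
  qed
  then have "linear m"
    using m(1) sublinear_minimal_imp_linear[of m] unfolding sublinear_def by blast
  then show ?thesis using m(2) by blast
qed

text \<open>Domination by \<open>slide q x0\<close> instead of \<open>q\<close> pins the value at
  \<open>x0\<close>: the slide is at most \<open>- q x0\<close> at \<open>- x0\<close>, which gives
  \<open>q x0 \<le> \<phi> x0\<close>.\<close>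

lemma hahn_banach_sublinear:
  fixes q :: "'a::real_vector \<Rightarrow> real"
  assumes q: "sublinear q"
  shows "\<exists>\<phi>. linear \<phi> \<and> (\<forall>x. \<phi> x \<le> q x) \<and> \<phi> x0 = q x0"
proof -
  obtain \<phi> where \<phi>: "linear \<phi>" "\<And>x. \<phi> x \<le> slide q x0 x"
    using ex_linear_le_sublinear[OF sublinear_slide[OF q]] by blast
  have le: "\<phi> x \<le> q x" for x
    using \<phi>(2)[of x] slide_le[OF q, of 0 x0 x] by simp
  have "\<phi> (- x0) \<le> - q x0"
    using \<phi>(2)[of "- x0"] slide_le[OF q, of 1 x0 "- x0"] sublinear_zero[OF q] by simp
  then have "q x0 \<le> \<phi> x0"
    using linear_neg[OF \<phi>(1), of x0] by simp
  then show ?thesis using \<phi>(1) le by (metis order_antisym)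
qed

text \<open>A linear projection onto \<open>L\<close> pulls \<open>q\<close> back to the whole type.
  Norms are meaningful only on carriers and gauges only on spans, so this restricted form is the one
  that gets applied.\<close>

lemma hahn_banach_on_subspace:
  fixes q :: "'a::real_vector \<Rightarrow> real"
  assumes L: "subspace L"
    and add: "\<And>x y. x \<in> L \<Longrightarrow> y \<in> L \<Longrightarrow> q (x + y) \<le> q x + q y"
    and hom: "\<And>c x. 0 < c \<Longrightarrow> x \<in> L \<Longrightarrow> q (c *\<^sub>R x) \<le> c * q x"
    and x0: "x0 \<in> L"
  shows "\<exists>\<phi>. linear \<phi> \<and> (\<forall>x\<in>L. \<phi> x \<le> q x) \<and> \<phi> x0 = q x0"
proof -
  obtain \<pi> :: "'a \<Rightarrow> 'a" where \<pi>: "range \<pi> \<subseteq> L" "linear \<pi>" "\<And>x. x \<in> L \<Longrightarrow> \<pi> x = x"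
    using linear_exists_left_inverse_on[OF linear_id L] by auto
  have "sublinear (q \<circ> \<pi>)"
    using \<pi> add hom unfolding sublinear_def
    by (auto simp: linear_add linear_cmul image_subset_iff)
  from hahn_banach_sublinear[OF this, of x0] show ?thesis
    using \<pi>(3) x0 by (auto, metis)
qed

text \<open>The Minkowski functional of \<open>C\<close>. For nonempty, convex and symmetric
  \<open>C\<close> the set is nonempty exactly at the points of \<open>span C\<close>; elsewhere its
  \<open>Inf\<close> carries no information.\<close>

definition gauge_of :: "'a::real_vector set \<Rightarrow> 'a \<Rightarrow> real" where
  "gauge_of C x = Inf {t. 0 < t \<and> (1/t) *\<^sub>R x \<in> C}"

text \<open>Purely algebraic: symmetry and convexity make \<open>C\<close> absorbing in its span,
  and the functional is one that attains the gauge at \<open>x0\<close>. Lying outside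
  \<open>C\<close> forces only a gauge of at least 1, so the separation is weak; the application
  supplies strictness through a norm below 1.\<close>

lemma hahn_banach_separation:
  fixes C :: "'a::real_vector set"
  assumes C: "convex C" "C \<noteq> {}" and sym: "\<And>x. x \<in> C \<Longrightarrow> - x \<in> C"
    and x: "x0 \<in> span C" "x0 \<notin> C"
  shows "\<exists>\<phi> :: 'a \<Rightarrow> real. linear \<phi> \<and> (\<forall>x\<in>C. \<phi> x \<le> 1) \<and> 1 \<le> \<phi> x0"
proof -
  define T where "T x = {t. 0 < t \<and> (1/t) *\<^sub>R x \<in> C}" for x
  have T_bdd: "bdd_below (T x)" for x
    by (rule bdd_belowI[of _ 0]) (auto simp: T_def)
  have g: "gauge_of C x = Inf (T x)" for x
    by (simp add: gauge_of_def T_def)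
  have zero: "0 \<in> C"
  proof -
    obtain c where c: "c \<in> C" using C by auto
    have "(1/2) *\<^sub>R c + (1/2) *\<^sub>R (- c) \<in> C"
      by (rule convexD[OF C(1) c sym[OF c]]) auto
    then show ?thesis by simp
  qed
  have shrink: "c *\<^sub>R y \<in> C" if "y \<in> C" "0 \<le> c" "c \<le> 1" for c y
    using convexD[OF C(1) that(1) zero, of c "1 - c"] that by simp
  have T_add: "s + t \<in> T (x + y)" if st: "s \<in> T x" "t \<in> T y" for s t x y
  proof -
    have "(s/(s+t)) *\<^sub>R ((1/s) *\<^sub>R x) + (t/(s+t)) *\<^sub>R ((1/t) *\<^sub>R y) \<in> C"
      using st by (intro convexD[OF C(1)]) (auto simp: T_def add_divide_distrib[symmetric])
    then show ?thesis
      using st by (auto simp: T_def scaleR_add_right)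
  qed
  have T_scale: "c * t \<in> T (c *\<^sub>R x)" if "t \<in> T x" "0 < c" for c t x
    using that by (auto simp: T_def)
  have T_neg: "t \<in> T (- x)" if "t \<in> T x" for t x
    using that sym by (auto simp: T_def)
  have T_ne: "T x \<noteq> {}" if "x \<in> span C" for x
    using that
  proof (induction rule: span_induct_alt)
    case base
    then show ?case using zero by (auto simp: T_def intro: exI[of _ 1])
  next
    case (step c x y)
    have one: "1 \<in> T x" using step by (simp add: T_def)
    have "T (c *\<^sub>R x) \<noteq> {}"
    proof (cases c "0::real" rule: linorder_cases)
      case less
      then show ?thesis using T_neg[OF T_scale[OF one, of "- c"]] by auto
    next
      case equal
      then show ?thesis using zero by (auto simp: T_def intro: exI[of _ 1])
    next
      case greater
      then show ?thesis using T_scale[OF one] by auto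
    qed
    then show ?case using T_add step by blast
  qed
  have "gauge_of C (x + y) \<le> gauge_of C x + gauge_of C y" if xy: "x \<in> span C" "y \<in> span C" for x y
  proof -
    have "gauge_of C (x + y) \<le> s + t" if "s \<in> T x" "t \<in> T y" for s t
      unfolding g using T_add[OF that] T_bdd by (rule cInf_lower)
    then have "gauge_of C (x + y) - s \<le> t" if "s \<in> T x" "t \<in> T y" for s t
      using that by (simp add: diff_le_eq add.commute)
    then have "gauge_of C (x + y) - s \<le> gauge_of C y" if "s \<in> T x" for s
      unfolding g[of y] using T_ne[OF xy(2)] that by (intro cInf_greatest) auto
    then have "gauge_of C (x + y) - gauge_of C y \<le> gauge_of C x"
      unfolding g[of x] using T_ne[OF xy(1)] by (intro cInf_greatest) (auto simp: algebra_simps)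
    then show ?thesis by simp
  qed
  moreover have "gauge_of C (c *\<^sub>R x) \<le> c * gauge_of C x" if "0 < c" "x \<in> span C" for c x
  proof -
    have "gauge_of C (c *\<^sub>R x) / c \<le> t" if "t \<in> T x" for t
    proof -
      have "gauge_of C (c *\<^sub>R x) \<le> c * t"
        unfolding g using T_scale[OF that \<open>0 < c\<close>] T_bdd by (rule cInf_lower)
      then show ?thesis using \<open>0 < c\<close> by (simp add: field_simps)
    qed
    then have "gauge_of C (c *\<^sub>R x) / c \<le> gauge_of C x"
      unfolding g[of x] using T_ne[OF that(2)] by (intro cInf_greatest) auto
    then show ?thesis using \<open>0 < c\<close> by (simp add: field_simps)
  qed
  ultimately obtain \<phi> where \<phi>: "linear \<phi>" "\<And>x. x \<in> span C \<Longrightarrow> \<phi> x \<le> gauge_of C x" "\<phi> x0 = gauge_of C x0"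
    using hahn_banach_on_subspace[OF subspace_span, of C "gauge_of C" x0] x(1) by blast
  have "gauge_of C x \<le> 1" if "x \<in> C" for x
    unfolding g using that T_bdd by (intro cInf_lower) (auto simp: T_def)
  moreover have "1 \<le> gauge_of C x0"
    unfolding g
  proof (rule cInf_greatest[OF T_ne[OF x(1)]])
    fix t
    assume t: "t \<in> T x0"
    show "1 \<le> t"
    proof (rule ccontr)
      assume "\<not> 1 \<le> t"
      have "t *\<^sub>R ((1/t) *\<^sub>R x0) \<in> C"
        by (rule shrink) (use t \<open>\<not> 1 \<le> t\<close> in \<open>simp_all add: T_def\<close>)
      then show False using t x(2) by (simp add: T_def)
    qed
  qed
  ultimately have "(\<forall>x\<in>C. \<phi> x \<le> 1) \<and> 1 \<le> \<phi> x0"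
    using \<phi>(3) order_trans[OF \<phi>(2)[OF span_base]] by auto
  then show ?thesis using \<phi>(1) by blast
qed

subsection \<open>Property (Z) and short chains in complete metric spaces\<close>

text \<open>Follow \<open>R\<close>-steps whose \<open>f\<close>-values come within
  \<open>(1/2)^n\<close> of the infimum over all successors. The values converge, so the points form
  a Cauchy sequence; closedness puts its limit above all of them, and whatever is above the limit is
  within every \<open>(1/2)^n\<close> of it. Reflexivity is assumed at \<open>x0\<close> and at
  successors because the relation to which this is applied has a threshold.\<close>

lemma caristi_order_maximal:
  fixes f :: "'a::complete_space \<Rightarrow> real" and R :: "'a \<Rightarrow> 'a \<Rightarrow> bool"
  assumes trans: "\<And>x y z. R x y \<Longrightarrow> R y z \<Longrightarrow> R x z"
    and refl: "\<And>x y. R x y \<Longrightarrow> R y y" "R x0 x0"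
    and dist: "\<And>x y. R x y \<Longrightarrow> dist x y \<le> f x - f y"
    and closed: "\<And>x. closed {y. R x y}"
    and bdd: "\<And>x. 0 \<le> f x"
  shows "\<exists>w. R x0 w \<and> (\<forall>z. R w z \<longrightarrow> z = w)"
proof -
  define I where "I x = (INF y\<in>{y. R x y}. f y)" for x
  have I_le: "I x \<le> f y" if "R x y" for x y
    unfolding I_def using that bdd by (intro cINF_lower bdd_belowI2[where m = 0]) auto
  have ex: "\<exists>y. R x y \<and> f y < I x + (1/2)^n" if "R x x" for x n
  proof (rule ccontr)
    assume "\<not> (\<exists>y. R x y \<and> f y < I x + (1/2)^n)"
    then have "I x + (1/2)^n \<le> I x"
      unfolding I_def[of x] using that by (intro cINF_greatest) (auto simp: I_def not_less)
    moreover have "(0::real) < (1/2)^n" by simp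
    ultimately show False by linarith
  qed
  obtain w where w: "w 0 = x0" "\<And>n. R x0 (w n)" "\<And>n. R (w n) (w (Suc n))"
    "\<And>n. f (w (Suc n)) < I (w n) + (1/2)^n"
  proof -
    have "\<exists>w. \<forall>n. (R x0 (w n) \<and> (n = 0 \<longrightarrow> w n = x0)) \<and>
        (R (w n) (w (Suc n)) \<and> f (w (Suc n)) < I (w n) + (1/2)^n)"
    proof (rule dependent_nat_choice)
      show "\<exists>x. R x0 x \<and> (0 = (0::nat) \<longrightarrow> x = x0)" using refl by blast
    next
      fix x n
      assume "R x0 x \<and> (n = (0::nat) \<longrightarrow> x = x0)"
      then show "\<exists>y. (R x0 y \<and> (Suc n = 0 \<longrightarrow> y = x0)) \<and> R x y \<and> f y < I x + (1/2)^n"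
        using ex[of x n] refl trans by (metis nat.distinct(1))
    qed
    then show ?thesis using that by blast
  qed
  have mono: "R (w m) (w n)" if "m \<le> n" for m n
    using that by (induction rule: dec_induct) (auto intro: refl(1) w trans)
  have "decseq (\<lambda>n. f (w n))"
    unfolding decseq_def
  proof (intro allI impI)
    fix m n :: nat
    assume "m \<le> n"
    then show "f (w n) \<le> f (w m)"
      using dist[OF mono[of m n]] zero_le_dist[of "w m" "w n"] by linarith
  qed
  then have "convergent (\<lambda>n. f (w n))"
    using bdd decseq_convergent[of "\<lambda>n. f (w n)" 0] unfolding convergent_def by metis
  then have C: "Cauchy (\<lambda>n. f (w n))" by (simp add: Cauchy_convergent_iff)
  have "Cauchy w"
  proof (rule metric_CauchyI)
    fix e :: real
    assume "0 < e"
    then obtain N where N: "\<And>m n. N \<le> m \<Longrightarrow> N \<le> n \<Longrightarrow> dist (f (w m)) (f (w n)) < e"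
      using C unfolding Cauchy_def by metis
    have "dist (w m) (w n) < e" if "N \<le> m" "m \<le> n" for m n
      using dist[OF mono[OF that(2)]] N[of m n] that by (auto simp: dist_real_def)
    then show "\<exists>N. \<forall>m\<ge>N. \<forall>n\<ge>N. dist (w m) (w n) < e"
      by (metis dist_commute nat_le_linear)
  qed
  then obtain l where l: "w \<longlonglongrightarrow> l"
    by (meson Cauchy_convergent_iff convergent_def)
  have Rl: "R (w n) l" for n
  proof -
    have "l \<in> {y. R (w n) y}"
      by (rule Lim_in_closed_set[OF closed _ _ l])
        (auto intro!: eventually_sequentiallyI[of n] mono)
    then show ?thesis by simp
  qed
  have "z = l" if "R l z" for z
  proof -
    have "dist l z \<le> (1/2)^n" for n
    proof -
      have "f l \<le> f (w (Suc n))"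
        using dist[OF Rl[of "Suc n"]] zero_le_dist[of "w (Suc n)" l] by linarith
      moreover have "I (w n) \<le> f z" using I_le trans Rl that by blast
      ultimately show ?thesis using w(4)[of n] dist[OF that] by linarith
    qed
    then have "dist l z \<le> 0"
      using LIMSEQ_power_zero[of "1/2::real"] by (intro LIMSEQ_le_const) auto
    then show ?thesis by simp
  qed
  then show ?thesis using Rl[of 0] w(1) by auto
qed

text \<open>This is property (Z) of Ivakhno, Kadets and Werner for one pair of points; the strict
  inequality forces \<open>z\<close> to differ from both of them.\<close>
definition nearly_between :: "'m::metric_space \<Rightarrow> 'm \<Rightarrow> bool" where
  "nearly_between x y \<longleftrightarrow>
     (\<forall>\<epsilon>>0. \<exists>z. dist x z + dist z y < dist x y + \<epsilon> * min (dist x z) (dist z y))"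

text \<open>At a maximal pair, let \<open>z\<close> be no farther from \<open>u\<close> than from
  \<open>v\<close>. Moving \<open>u\<close> to \<open>z\<close> would be admissible unless
  \<open>z\<close> and \<open>v\<close> were less than half of \<open>dist x y\<close> apart, so
  maximality makes both inner steps short. The outer steps are short because \<open>u\<close> and
  \<open>v\<close> keep at least half of \<open>dist x y\<close> and the moves are paid out of the
  rest.\<close>

lemma nearly_between_halving:
  fixes x y :: "'m::complete_space"
  assumes Z: "\<And>u v :: 'm. u \<noteq> v \<Longrightarrow> nearly_between u v"
    and eps: "0 < \<epsilon>" "\<epsilon> < 1"
  shows "\<exists>u z v. (1 - \<epsilon>) * (dist x u + dist u z + dist z v + dist v y) \<le> dist x y \<and>
    2 * (1 - \<epsilon>) * dist x u \<le> dist x y \<and> 2 * (1 - \<epsilon>) * dist u z \<le> dist x y \<and>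
    2 * (1 - \<epsilon>) * dist z v \<le> dist x y \<and> 2 * (1 - \<epsilon>) * dist v y \<le> dist x y"
proof (cases "x = y")
  case True
  then show ?thesis by (intro exI[of _ x]) auto
next
  case False
  let ?a = "dist x y" and ?c = "1 - \<epsilon>"
  \<comment> \<open>The first clause is the threshold that stops the inward motion. The second makes
    every unit of motion cost \<open>1 - \<epsilon>\<close> of the distance of the pair, so this
    distance divided by \<open>?c\<close> is the Caristi potential.\<close>
  define R where "R s t \<longleftrightarrow> ?a \<le> 2 * dist (fst t) (snd t) \<and>
      dist (fst t) (snd t) + ?c * (dist (fst s) (fst t) + dist (snd s) (snd t)) \<le> dist (fst s) (snd s)"
    for s t :: "'m \<times> 'm"
  have c: "0 < ?c" using eps by simp
  have "\<exists>w. R (x, y) w \<and> (\<forall>z. R w z \<longrightarrow> z = w)"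
  proof (rule caristi_order_maximal[where f = "\<lambda>s. dist (fst s) (snd s) / ?c"])
    fix s t r
    assume st: "R s t" and tr: "R t r"
    have "dist (fst s) (fst r) + dist (snd s) (snd r) \<le>
        (dist (fst s) (fst t) + dist (snd s) (snd t)) + (dist (fst t) (fst r) + dist (snd t) (snd r))"
      using dist_triangle[of "fst s" "fst r" "fst t"] dist_triangle[of "snd s" "snd r" "snd t"]
      by linarith
    then have "?c * (dist (fst s) (fst r) + dist (snd s) (snd r)) \<le>
        ?c * (dist (fst s) (fst t) + dist (snd s) (snd t)) +
        ?c * (dist (fst t) (fst r) + dist (snd t) (snd r))"
      using c by (simp only: mult_le_cancel_left_pos distrib_left[symmetric])
    then show "R s r" using st tr unfolding R_def by linarith
  next
    fix s t
    assume st: "R s t"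
    then show "R t t" by (simp add: R_def)
    have "dist s t \<le> dist (fst s) (fst t) + dist (snd s) (snd t)"
      by (simp add: dist_prod_def sqrt_sum_squares_le_sum)
    also have "\<dots> \<le> (dist (fst s) (snd s) - dist (fst t) (snd t)) / ?c"
      using st c by (simp add: R_def field_simps)
    finally show "dist s t \<le> dist (fst s) (snd s) / ?c - dist (fst t) (snd t) / ?c"
      by (simp add: diff_divide_distrib)
  next
    fix s
    show "closed {t. R s t}"
      unfolding R_def
      by (intro closed_Collect_conj closed_Collect_le continuous_intros)
  qed (use c in \<open>auto simp: R_def\<close>)
  then obtain u v where uv: "R (x, y) (u, v)" and max: "\<And>s. R (u, v) s \<Longrightarrow> s = (u, v)"
    by auto
  from uv have half: "?a \<le> 2 * dist u v" and le: "dist u v + ?c * (dist x u + dist v y) \<le> ?a"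
    by (auto simp: R_def dist_commute)
  have "u \<noteq> v" using half False by auto
  then obtain z where z: "dist u z + dist z v < dist u v + \<epsilon> * min (dist u z) (dist z v)"
    using Z eps unfolding nearly_between_def by blast
  then have ne: "z \<noteq> u" "z \<noteq> v" by auto
  have short: "2 * dist u z < ?a \<and> 2 * dist z v < ?a"
  proof (cases "dist u z \<le> dist z v")
    case True
    then have "dist z v + ?c * dist u z \<le> dist u v"
      using z by (simp add: algebra_simps)
    then have "2 * dist z v < ?a"
      using max[of "(z, v)"] ne by (fastforce simp: R_def not_le)
    then show ?thesis using True by simp
  next
    case False
    then have "dist u z + ?c * dist z v \<le> dist u v"
      using z by (simp add: algebra_simps)
    then have "2 * dist u z < ?a"
      using max[of "(u, z)"] ne by (fastforce simp: R_def not_le dist_commute)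
    then show ?thesis using False by simp
  qed
  have "?c * (dist u z + dist z v) \<le> dist u v"
  proof -
    have "\<epsilon> * min (dist u z) (dist z v) \<le> \<epsilon> * (dist u z + dist z v)"
      using eps min.cobounded1[of "dist u z" "dist z v"]
      by (intro mult_left_mono) (auto intro: add_increasing2)
    then show ?thesis using z by (simp add: algebra_simps)
  qed
  then have total: "?c * (dist x u + dist u z + dist z v + dist v y) \<le> ?a"
    using le by (simp add: algebra_simps)
  have bound: "2 * ?c * t \<le> ?a" if "2 * t \<le> ?a" "0 \<le> t" for t
  proof -
    have "?c * (2 * t) \<le> 1 * (2 * t)" using that eps by (intro mult_right_mono) auto
    then show ?thesis using that by (simp only: mult.assoc mult.left_commute mult_1)
  qed
  have "2 * ?c * dist x u \<le> ?a" "2 * ?c * dist v y \<le> ?a"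
    using le half mult_nonneg_nonneg[of ?c "dist x u"] mult_nonneg_nonneg[of ?c "dist v y"] c
    by (simp_all add: algebra_simps)
  then show ?thesis
    using total bound[of "dist u z"] bound[of "dist z v"] short
    by (intro exI[of _ u] exI[of _ z] exI[of _ v]) auto
qed

inductive chain :: "real \<Rightarrow> 'm::metric_space \<Rightarrow> 'm \<Rightarrow> real \<Rightarrow> bool" for \<delta> where
  stop: "chain \<delta> x x 0"
| step: "dist x y \<le> \<delta> \<Longrightarrow> chain \<delta> y z t \<Longrightarrow> chain \<delta> x z (dist x y + t)"

lemma chain_trans: "chain \<delta> x y s \<Longrightarrow> chain \<delta> y z t \<Longrightarrow> chain \<delta> x z (s + t)"
  by (induction rule: chain.induct) (auto simp: add.assoc intro: chain.step)

lemma chain_mono: "chain \<delta> x y t \<Longrightarrow> \<delta> \<le> \<delta>' \<Longrightarrow> chain \<delta>' x y t"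
  by (induction rule: chain.induct) (auto intro: chain.intros)

lemma dist_le_chain: "chain \<delta> x y t \<Longrightarrow> dist x y \<le> t"
proof (induction rule: chain.induct)
  case (step x y z t)
  then show ?case using dist_triangle[of x z y] by linarith
qed simp

text \<open>Each halving divides the mesh by \<open>2 * (1 - \<epsilon>)\<close>, which is at least
  3/2 because of \<open>\<epsilon> \<le> 1/4\<close>, and costs one factor
  \<open>1 - \<epsilon>\<close> in length.\<close>

lemma nearly_between_imp_chain_power:
  fixes x y :: "'m::complete_space"
  assumes Z: "\<And>u v :: 'm. u \<noteq> v \<Longrightarrow> nearly_between u v"
    and eps: "0 < \<epsilon>" "\<epsilon> \<le> 1/4"
  shows "\<exists>t. (1 - \<epsilon>)^n * t \<le> dist x y \<and> chain ((2/3)^n * dist x y) x y t"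
proof (induction n arbitrary: x y)
  case 0
  have "chain (dist x y) x y (dist x y + 0)"
    by (intro chain.intros) auto
  then show ?case by auto
next
  case (Suc n)
  obtain u z v where
    total: "(1 - \<epsilon>) * (dist x u + dist u z + dist z v + dist v y) \<le> dist x y" and
    small: "2 * (1 - \<epsilon>) * dist x u \<le> dist x y" "2 * (1 - \<epsilon>) * dist u z \<le> dist x y"
      "2 * (1 - \<epsilon>) * dist z v \<le> dist x y" "2 * (1 - \<epsilon>) * dist v y \<le> dist x y"
    using nearly_between_halving[OF Z, of \<epsilon> x y] eps by auto
  have sub: "\<exists>t. (1 - \<epsilon>)^n * t \<le> dist s r \<and> chain ((2/3)^Suc n * dist x y) s r t"
    if "2 * (1 - \<epsilon>) * dist s r \<le> dist x y" for s r :: 'm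
  proof -
    have "3/2 * dist s r \<le> 2 * (1 - \<epsilon>) * dist s r"
      using eps by (intro mult_right_mono) auto
    then have "dist s r \<le> 2/3 * dist x y" using that by simp
    then have "(2/3)^n * dist s r \<le> (2/3)^n * (2/3 * dist x y)"
      by (intro mult_left_mono) auto
    then show ?thesis using Suc[of s r] chain_mono by (fastforce simp: mult.assoc mult.left_commute)
  qed
  obtain t1 t2 t3 t4 where t:
    "(1 - \<epsilon>)^n * t1 \<le> dist x u" "chain ((2/3)^Suc n * dist x y) x u t1"
    "(1 - \<epsilon>)^n * t2 \<le> dist u z" "chain ((2/3)^Suc n * dist x y) u z t2"
    "(1 - \<epsilon>)^n * t3 \<le> dist z v" "chain ((2/3)^Suc n * dist x y) z v t3"
    "(1 - \<epsilon>)^n * t4 \<le> dist v y" "chain ((2/3)^Suc n * dist x y) v y t4"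
    using sub small by meson
  have "(1 - \<epsilon>)^n * (t1 + (t2 + (t3 + t4))) \<le> dist x u + dist u z + dist z v + dist v y"
    using t by (simp add: algebra_simps)
  then have "(1 - \<epsilon>) * ((1 - \<epsilon>)^n * (t1 + (t2 + (t3 + t4)))) \<le>
      (1 - \<epsilon>) * (dist x u + dist u z + dist z v + dist v y)"
    using eps by (intro mult_left_mono) auto
  then have "(1 - \<epsilon>)^Suc n * (t1 + (t2 + (t3 + t4))) \<le> dist x y"
    using total by (simp add: mult.assoc)
  then show ?case using t chain_trans by blast
qed

lemma nearly_between_imp_chain:
  fixes x y :: "'m::complete_space"
  assumes Z: "\<And>u v :: 'm. u \<noteq> v \<Longrightarrow> nearly_between u v"
    and "0 < \<delta>" "0 < \<eta>"
  shows "\<exists>t. t \<le> (1 + \<eta>) * dist x y \<and> chain \<delta> x y t"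
proof -
  have "(\<lambda>n. (2/3)^n * dist x y) \<longlonglongrightarrow> 0 * dist x y"
    by (intro tendsto_intros LIMSEQ_power_zero) auto
  then have "eventually (\<lambda>n. (2/3)^n * dist x y < \<delta>) sequentially"
    using order_tendstoD(2)[of _ 0] \<open>0 < \<delta>\<close> by simp
  then obtain n where n: "(2/3)^n * dist x y < \<delta>"
    by (auto simp: eventually_sequentially)
  \<comment> \<open>\<open>n\<close> is fixed by the mesh before \<open>\<epsilon>\<close> is
    chosen. Then \<open>n * \<epsilon>\<close> is at most \<open>\<eta> / (1 + \<eta>)\<close>, and
    Bernoulli's inequality bounds \<open>(1 - \<epsilon>)^n\<close> below by
    \<open>1 / (1 + \<eta>)\<close>. The summand 1 avoids division by zero.\<close>
  define \<epsilon> where "\<epsilon> = min (1/4) (\<eta> / ((1 + \<eta>) * (real n + 1)))"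
  have eps: "0 < \<epsilon>" "\<epsilon> \<le> 1/4"
    using \<open>0 < \<eta>\<close> min.cobounded1[of "1/4::real"] by (simp add: \<epsilon>_def) (simp only: \<epsilon>_def)
  obtain t where t: "(1 - \<epsilon>)^n * t \<le> dist x y" "chain ((2/3)^n * dist x y) x y t"
    using nearly_between_imp_chain_power[OF Z eps] by blast
  have "real n * \<epsilon> \<le> (real n + 1) * (\<eta> / ((1 + \<eta>) * (real n + 1)))"
    using eps \<open>0 < \<eta>\<close> by (intro mult_mono) (auto simp: \<epsilon>_def)
  also have "\<dots> = \<eta> / (1 + \<eta>)" by (simp add: add_nonneg_eq_0_iff)
  finally have "1 / (1 + \<eta>) \<le> 1 + real n * (- \<epsilon>)"
    using \<open>0 < \<eta>\<close> by (simp add: field_simps)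
  also have "\<dots> \<le> (1 - \<epsilon>)^n"
    using Bernoulli_inequality[of "- \<epsilon>" n] eps by simp
  finally have "1 / (1 + \<eta>) * t \<le> (1 - \<epsilon>)^n * t"
    using dist_le_chain[OF t(2)] zero_le_dist[of x y] by (intro mult_right_mono) linarith+
  then have "1 / (1 + \<eta>) * t \<le> dist x y" using t(1) by linarith
  then have "t \<le> (1 + \<eta>) * dist x y"
    using \<open>0 < \<eta>\<close> by (simp add: field_simps)
  then show ?thesis using chain_mono[OF t(2)] n by auto
qed

subsection \<open>Normed spaces, duals and spaces of Lipschitz maps\<close>

lemma fun_scaleR_apply [simp]: "(c *\<^sub>R f) x = c *\<^sub>R f x"
  by (simp add: scaleR_fun_def)

lemma
  assumes "normed_space Z"
  shows subspace_vecs: "subspace (vecs Z)"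
    and vecs_zero: "0 \<in> vecs Z"
    and vecs_add: "x \<in> vecs Z \<Longrightarrow> y \<in> vecs Z \<Longrightarrow> x + y \<in> vecs Z"
    and vecs_diff: "x \<in> vecs Z \<Longrightarrow> y \<in> vecs Z \<Longrightarrow> x - y \<in> vecs Z"
    and vecs_scale: "x \<in> vecs Z \<Longrightarrow> c *\<^sub>R x \<in> vecs Z"
    and vecs_neg: "x \<in> vecs Z \<Longrightarrow> - x \<in> vecs Z"
    and nrm_nonneg: "x \<in> vecs Z \<Longrightarrow> 0 \<le> nrm Z x"
    and nrm_eq_0: "x \<in> vecs Z \<Longrightarrow> nrm Z x = 0 \<longleftrightarrow> x = 0"
    and nrm_scale: "x \<in> vecs Z \<Longrightarrow> nrm Z (c *\<^sub>R x) = \<bar>c\<bar> * nrm Z x"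
    and nrm_add: "x \<in> vecs Z \<Longrightarrow> y \<in> vecs Z \<Longrightarrow> nrm Z (x + y) \<le> nrm Z x + nrm Z y"
  using assms
  by (auto simp: normed_space_def subspace_0 subspace_add subspace_diff subspace_scale subspace_neg)

lemma nrm_zero: "normed_space Z \<Longrightarrow> nrm Z 0 = 0"
  using nrm_eq_0 vecs_zero by blast

lemma nrm_minus: "normed_space Z \<Longrightarrow> x \<in> vecs Z \<Longrightarrow> nrm Z (- x) = nrm Z x"
  using nrm_scale[of Z x "- 1"] by simp

lemma nrm_diff_commute:
  "normed_space Z \<Longrightarrow> x \<in> vecs Z \<Longrightarrow> y \<in> vecs Z \<Longrightarrow> nrm Z (x - y) = nrm Z (y - x)"
  using nrm_minus[of Z "x - y"] vecs_diff[of Z x y] by simp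

lemma nrm_triangle:
  assumes "normed_space Z" "x \<in> vecs Z" "y \<in> vecs Z" "z \<in> vecs Z"
  shows "nrm Z (x - z) \<le> nrm Z (x - y) + nrm Z (y - z)"
  using nrm_add[OF assms(1) vecs_diff[OF assms(1-3)] vecs_diff[OF assms(1,3,4)]] by simp

lemma nrm_le_diff_add:
  assumes "normed_space Z" "x \<in> vecs Z" "y \<in> vecs Z"
  shows "nrm Z x \<le> nrm Z (x - y) + nrm Z y"
  using nrm_add[OF assms(1) vecs_diff[OF assms] assms(3)] by simp

lemma unit_ball_zero: "normed_space Z \<Longrightarrow> 0 \<in> unit_ball Z"
  by (simp add: unit_ball_def vecs_zero nrm_zero)

lemma convex_unit_ball:
  assumes Z: "normed_space Z"
  shows "convex (unit_ball Z)"
proof (rule convexI)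
  fix x y and u v :: real
  assume xy: "x \<in> unit_ball Z" "y \<in> unit_ball Z" and uv: "0 \<le> u" "0 \<le> v" "u + v = 1"
  have mem: "u *\<^sub>R x \<in> vecs Z" "v *\<^sub>R y \<in> vecs Z"
    using xy vecs_scale[OF Z] by (auto simp: unit_ball_def)
  have "nrm Z (u *\<^sub>R x + v *\<^sub>R y) \<le> u * nrm Z x + v * nrm Z y"
    using nrm_add[OF Z mem] xy uv nrm_scale[OF Z] by (simp add: unit_ball_def)
  also have "\<dots> \<le> u * 1 + v * 1"
    using xy uv by (intro add_mono mult_left_mono) (auto simp: unit_ball_def)
  finally show "u *\<^sub>R x + v *\<^sub>R y \<in> unit_ball Z"
    using uv vecs_add[OF Z mem] by (simp add: unit_ball_def)
qed

lemma norm_closureD: "z \<in> norm_closure Z S \<Longrightarrow> 0 < e \<Longrightarrow> \<exists>s\<in>S. nrm Z (z - s) < e"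
  by (simp add: norm_closure_def)

lemma norm_closure_subset_unit_ball:
  assumes Z: "normed_space Z" and S: "S \<subseteq> unit_ball Z"
  shows "norm_closure Z S \<subseteq> unit_ball Z"
proof
  fix z
  assume z: "z \<in> norm_closure Z S"
  have "nrm Z z \<le> 1 + e" if "0 < e" for e
  proof -
    obtain s where s: "s \<in> S" "nrm Z (z - s) < e"
      using z \<open>0 < e\<close> unfolding norm_closure_def by blast
    then show ?thesis
      using nrm_le_diff_add[OF Z, of z s] S z by (auto simp: norm_closure_def unit_ball_def)
  qed
  then show "z \<in> unit_ball Z"
    using z by (auto simp: unit_ball_def norm_closure_def intro: field_le_epsilon)
qed

lemma subspace_norm_closure:
  assumes Z: "normed_space Z" and S: "subspace S" "S \<subseteq> vecs Z"
  shows "subspace (norm_closure Z S)"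
proof (rule subspaceI)
  show "0 \<in> norm_closure Z S"
    using vecs_zero[OF Z] nrm_zero[OF Z] subspace_0[OF S(1)]
    by (auto simp: norm_closure_def intro!: bexI[of _ 0])
next
  fix x y
  assume xy: "x \<in> norm_closure Z S" "y \<in> norm_closure Z S"
  then have mem: "x \<in> vecs Z" "y \<in> vecs Z" by (auto simp: norm_closure_def)
  have "\<exists>s\<in>S. nrm Z (x + y - s) < e" if "0 < e" for e
  proof -
    have "0 < e/2" using that by simp
    then obtain s t where st: "s \<in> S" "t \<in> S" "nrm Z (x - s) < e/2" "nrm Z (y - t) < e/2"
      using norm_closureD[OF xy(1)] norm_closureD[OF xy(2)] by meson
    have "nrm Z ((x - s) + (y - t)) < e"
      using nrm_add[OF Z vecs_diff[OF Z mem(1)] vecs_diff[OF Z mem(2)], of s t] st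
        subsetD[OF S(2) st(1)] subsetD[OF S(2) st(2)] by linarith
    then show ?thesis
      using subspace_add[OF S(1) st(1,2)] by (intro bexI[of _ "s + t"]) (auto simp: algebra_simps)
  qed
  then show "x + y \<in> norm_closure Z S"
    using vecs_add[OF Z mem] by (simp add: norm_closure_def)
next
  fix c x
  assume x: "x \<in> norm_closure Z S"
  then have mem: "x \<in> vecs Z" by (auto simp: norm_closure_def)
  have "\<exists>s\<in>S. nrm Z (c *\<^sub>R x - s) < e" if "0 < e" for e
  proof -
    have "0 < e / (\<bar>c\<bar> + 1)" using that by (intro divide_pos_pos) auto
    then obtain s where s: "s \<in> S" "nrm Z (x - s) < e / (\<bar>c\<bar> + 1)"
      using norm_closureD[OF x] by blast
    have xs: "x - s \<in> vecs Z" using vecs_diff[OF Z mem] s S by auto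
    have "nrm Z (c *\<^sub>R x - c *\<^sub>R s) = \<bar>c\<bar> * nrm Z (x - s)"
      using nrm_scale[OF Z xs, of c] by (simp add: scaleR_diff_right)
    also have "\<dots> \<le> (\<bar>c\<bar> + 1) * nrm Z (x - s)"
      using nrm_nonneg[OF Z xs] by (intro mult_right_mono) auto
    also have "\<dots> < e" using s(2) by (simp add: field_simps)
    finally show ?thesis using subspace_scale[OF S(1) s(1)] by blast
  qed
  then show "c *\<^sub>R x \<in> norm_closure Z S"
    using vecs_scale[OF Z mem] by (simp add: norm_closure_def)
qed

lemma vecs_dual:
  "\<phi> \<in> vecs (dual Z) \<longleftrightarrow> (\<forall>x\<in>vecs Z. \<forall>y\<in>vecs Z. \<phi> (x + y) = \<phi> x + \<phi> y) \<and>
     (\<forall>x\<in>vecs Z. \<forall>c. \<phi> (c *\<^sub>R x) = c * \<phi> x) \<and>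
     (\<exists>C. \<forall>x\<in>vecs Z. \<bar>\<phi> x\<bar> \<le> C * nrm Z x) \<and> (\<forall>x. x \<notin> vecs Z \<longrightarrow> \<phi> x = 0)"
  by (simp add: dual_def)

lemma
  assumes "\<phi> \<in> vecs (dual Z)"
  shows dual_add: "x \<in> vecs Z \<Longrightarrow> y \<in> vecs Z \<Longrightarrow> \<phi> (x + y) = \<phi> x + \<phi> y"
    and dual_scale: "x \<in> vecs Z \<Longrightarrow> \<phi> (c *\<^sub>R x) = c * \<phi> x"
  using assms by (simp_all add: dual_def)

lemma nrm_dual_le:
  assumes Z: "normed_space Z" and le: "\<And>x. x \<in> unit_ball Z \<Longrightarrow> \<bar>\<phi> x\<bar> \<le> K"
  shows "nrm (dual Z) \<phi> \<le> K"
  using unit_ball_zero[OF Z] le by (auto simp: dual_def intro!: cSUP_least)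

lemma abs_le_nrm_dual:
  assumes Z: "normed_space Z" and \<phi>: "\<phi> \<in> vecs (dual Z)" and x: "x \<in> vecs Z"
  shows "\<bar>\<phi> x\<bar> \<le> nrm (dual Z) \<phi> * nrm Z x"
proof (cases "x = 0")
  case True
  have "\<phi> (0 *\<^sub>R x) = 0 * \<phi> x" using dual_scale[OF \<phi> x] .
  then show ?thesis using True nrm_zero[OF Z] by simp
next
  case False
  then have pos: "0 < nrm Z x"
    using nrm_nonneg[OF Z x] nrm_eq_0[OF Z x] by simp
  obtain C where C: "\<And>x. x \<in> vecs Z \<Longrightarrow> \<bar>\<phi> x\<bar> \<le> C * nrm Z x"
    using \<phi> unfolding vecs_dual by metis
  have "\<bar>\<phi> y\<bar> \<le> \<bar>C\<bar>" if "y \<in> unit_ball Z" for y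
  proof -
    have "C * nrm Z y \<le> \<bar>C\<bar> * 1"
      using that nrm_nonneg[OF Z] by (intro mult_mono) (auto simp: unit_ball_def)
    then show ?thesis using C[of y] that by (simp add: unit_ball_def)
  qed
  then have "bdd_above ((\<lambda>x. \<bar>\<phi> x\<bar>) ` unit_ball Z)"
    by (intro bdd_aboveI2)
  moreover have "(1 / nrm Z x) *\<^sub>R x \<in> unit_ball Z"
    using vecs_scale[OF Z x] nrm_scale[OF Z x, of "1 / nrm Z x"] pos by (simp add: unit_ball_def)
  ultimately have "\<bar>\<phi> ((1 / nrm Z x) *\<^sub>R x)\<bar> \<le> nrm (dual Z) \<phi>"
    by (auto simp: dual_def intro: cSUP_upper2)
  moreover have "\<phi> ((1 / nrm Z x) *\<^sub>R x) = (1 / nrm Z x) * \<phi> x"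
    using dual_scale[OF \<phi> x] .
  ultimately show ?thesis using pos by (simp add: abs_mult field_simps)
qed

lemma normed_space_dual:
  assumes Z: "normed_space Z"
  shows "normed_space (dual Z)"
proof -
  have sub: "subspace (vecs (dual Z))"
  proof (rule subspaceI)
    show "0 \<in> vecs (dual Z)" by (auto simp: vecs_dual intro: exI[of _ 0])
  next
    fix \<phi> \<psi>
    assume \<phi>: "\<phi> \<in> vecs (dual Z)" and \<psi>: "\<psi> \<in> vecs (dual Z)"
    have "\<bar>\<phi> x + \<psi> x\<bar> \<le> (nrm (dual Z) \<phi> + nrm (dual Z) \<psi>) * nrm Z x" if "x \<in> vecs Z" for x
      using abs_le_nrm_dual[OF Z \<phi> that] abs_le_nrm_dual[OF Z \<psi> that] by (simp add: distrib_right)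
    then have "\<exists>C. \<forall>x\<in>vecs Z. \<bar>(\<phi> + \<psi>) x\<bar> \<le> C * nrm Z x"
      by (intro exI[of _ "nrm (dual Z) \<phi> + nrm (dual Z) \<psi>"]) simp
    then show "\<phi> + \<psi> \<in> vecs (dual Z)"
      using \<phi> \<psi> unfolding vecs_dual by (simp add: algebra_simps)
  next
    fix c \<phi>
    assume \<phi>: "\<phi> \<in> vecs (dual Z)"
    have "\<bar>c * \<phi> x\<bar> \<le> (\<bar>c\<bar> * nrm (dual Z) \<phi>) * nrm Z x" if "x \<in> vecs Z" for x
      using mult_left_mono[OF abs_le_nrm_dual[OF Z \<phi> that], of "\<bar>c\<bar>"]
      by (simp add: abs_mult mult.assoc)
    then have "\<exists>C. \<forall>x\<in>vecs Z. \<bar>(c *\<^sub>R \<phi>) x\<bar> \<le> C * nrm Z x"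
      by (intro exI[of _ "\<bar>c\<bar> * nrm (dual Z) \<phi>"]) simp
    then show "c *\<^sub>R \<phi> \<in> vecs (dual Z)"
      using \<phi> unfolding vecs_dual by (simp add: algebra_simps)
  qed
  have nonneg: "0 \<le> nrm (dual Z) \<phi>" if "\<phi> \<in> vecs (dual Z)" for \<phi>
  proof -
    have "bdd_above ((\<lambda>x. \<bar>\<phi> x\<bar>) ` unit_ball Z)"
    proof (rule bdd_aboveI2)
      fix x assume x: "x \<in> unit_ball Z"
      have "nrm (dual Z) \<phi> * nrm Z x \<le> \<bar>nrm (dual Z) \<phi>\<bar> * 1"
        using x nrm_nonneg[OF Z] by (intro mult_mono) (auto simp: unit_ball_def)
      then show "\<bar>\<phi> x\<bar> \<le> \<bar>nrm (dual Z) \<phi>\<bar>"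
        using abs_le_nrm_dual[OF Z that, of x] x by (simp add: unit_ball_def)
    qed
    then show ?thesis
      using unit_ball_zero[OF Z] by (auto simp: dual_def intro: cSUP_upper2)
  qed
  have ball_le: "\<bar>\<phi> x\<bar> \<le> nrm (dual Z) \<phi>" if "\<phi> \<in> vecs (dual Z)" "x \<in> unit_ball Z" for \<phi> x
    using abs_le_nrm_dual[OF Z that(1), of x] mult_left_mono[OF _ nonneg[OF that(1)], of "nrm Z x" 1] that(2)
    by (simp add: unit_ball_def)
  have add: "nrm (dual Z) (\<phi> + \<psi>) \<le> nrm (dual Z) \<phi> + nrm (dual Z) \<psi>"
    if "\<phi> \<in> vecs (dual Z)" "\<psi> \<in> vecs (dual Z)" for \<phi> \<psi>
  proof (rule nrm_dual_le[OF Z])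
    fix x assume "x \<in> unit_ball Z"
    then show "\<bar>(\<phi> + \<psi>) x\<bar> \<le> nrm (dual Z) \<phi> + nrm (dual Z) \<psi>"
      using ball_le[OF that(1), of x] ball_le[OF that(2), of x] by simp
  qed
  have scale_le: "nrm (dual Z) (c *\<^sub>R \<phi>) \<le> \<bar>c\<bar> * nrm (dual Z) \<phi>" if "\<phi> \<in> vecs (dual Z)" for c \<phi>
    using ball_le[OF that] by (intro nrm_dual_le[OF Z]) (simp add: abs_mult mult_left_mono)
  have scale: "nrm (dual Z) (c *\<^sub>R \<phi>) = \<bar>c\<bar> * nrm (dual Z) \<phi>" if \<phi>: "\<phi> \<in> vecs (dual Z)" for c \<phi>
  proof (cases "c = 0")
    case True
    then show ?thesis using scale_le[OF \<phi>, of 0] nonneg[OF subspace_0[OF sub]] by simp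
  next
    case False
    then have "nrm (dual Z) \<phi> \<le> \<bar>1/c\<bar> * nrm (dual Z) (c *\<^sub>R \<phi>)"
      using scale_le[OF subspace_scale[OF sub \<phi>, of c], of "1/c"] by simp
    then show ?thesis
      using False scale_le[OF \<phi>, of c] by (simp add: field_simps)
  qed
  have zero: "\<phi> = 0" if \<phi>: "\<phi> \<in> vecs (dual Z)" and "nrm (dual Z) \<phi> = 0" for \<phi>
  proof
    fix x
    show "\<phi> x = 0 x"
    proof (cases "x \<in> vecs Z")
      case True
      then show ?thesis using abs_le_nrm_dual[OF Z \<phi> True] that by simp
    next
      case False
      then show ?thesis using \<phi> by (simp add: vecs_dual)
    qed
  qed
  show ?thesis
    unfolding normed_space_def
    using sub nonneg zero scale add scale[OF subspace_0[OF sub], of 0] by auto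
qed

lemma unit_ball_dual:
  assumes Z: "normed_space Z"
  shows "\<phi> \<in> unit_ball (dual Z) \<longleftrightarrow> \<phi> \<in> vecs (dual Z) \<and> (\<forall>x\<in>vecs Z. \<bar>\<phi> x\<bar> \<le> nrm Z x)"
proof (intro iffI conjI ballI)
  assume \<phi>: "\<phi> \<in> unit_ball (dual Z)"
  then show "\<phi> \<in> vecs (dual Z)" by (simp add: unit_ball_def)
  fix x assume x: "x \<in> vecs Z"
  show "\<bar>\<phi> x\<bar> \<le> nrm Z x"
    using abs_le_nrm_dual[OF Z _ x, of \<phi>] \<phi> mult_right_mono[OF _ nrm_nonneg[OF Z x], of "nrm (dual Z) \<phi>" 1]
    by (simp add: unit_ball_def)
next
  assume "\<phi> \<in> vecs (dual Z) \<and> (\<forall>x\<in>vecs Z. \<bar>\<phi> x\<bar> \<le> nrm Z x)"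
  then show "\<phi> \<in> unit_ball (dual Z)"
    using nrm_dual_le[OF Z, of \<phi> 1] by (force simp: unit_ball_def)
qed

lemma ex_norming_functional:
  assumes Z: "normed_space Z" and v: "v \<in> vecs Z"
  shows "\<exists>\<phi>\<in>unit_ball (dual Z). \<phi> v = nrm Z v"
proof -
  obtain \<phi> where \<phi>: "linear \<phi>" "\<And>x. x \<in> vecs Z \<Longrightarrow> \<phi> x \<le> nrm Z x" "\<phi> v = nrm Z v"
    using hahn_banach_on_subspace[OF subspace_vecs[OF Z], of "nrm Z" v]
      nrm_add[OF Z] nrm_scale[OF Z] v by auto
  have abs: "\<bar>\<phi> x\<bar> \<le> nrm Z x" if "x \<in> vecs Z" for x
    using \<phi>(2)[OF that] \<phi>(2)[OF vecs_neg[OF Z that]] linear_neg[OF \<phi>(1), of x] nrm_minus[OF Z that]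
    by simp
  \<comment> \<open>Cut off outside the carrier to obtain the canonical representative in
    \<open>dual Z\<close>.\<close>
  let ?\<psi> = "\<lambda>x. if x \<in> vecs Z then \<phi> x else 0"
  have "?\<psi> \<in> vecs (dual Z)"
    using abs vecs_add[OF Z] vecs_scale[OF Z] \<phi>(1)
    by (auto simp: vecs_dual linear_add linear_cmul intro: exI[of _ 1])
  then show ?thesis
    using abs v \<phi>(3) by (intro bexI[of _ ?\<psi>]) (auto simp: unit_ball_dual[OF Z])
qed

lemma vecs_Lip0:
  "f \<in> vecs (Lip0 p Z) \<longleftrightarrow>
     (\<forall>m. f m \<in> vecs Z) \<and> f p = 0 \<and> (\<exists>C. \<forall>x y. nrm Z (f x - f y) \<le> C * dist x y)"
  by (simp add: Lip0_def)

text \<open>A point other than \<open>p\<close> makes the set of slopes nonempty, so that its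
  \<open>Sup\<close> is a genuine supremum.\<close>

lemma nrm_Lip0_le:
  fixes p :: "'m::metric_space"
  assumes "\<exists>m :: 'm. m \<noteq> p" and le: "\<And>x y. nrm Z (f x - f y) \<le> K * dist x y"
  shows "nrm (Lip0 p Z) f \<le> K"
proof -
  have "Sup {nrm Z (f x - f y) / dist x y | x y. x \<noteq> y} \<le> K"
    using assms by (intro cSup_least) (auto simp: divide_le_eq)
  then show ?thesis by (simp add: Lip0_def)
qed

lemma nrm_diff_le_Lip0:
  assumes Z: "normed_space Z" and f: "f \<in> vecs (Lip0 p Z)"
  shows "nrm Z (f x - f y) \<le> nrm (Lip0 p Z) f * dist x y"
proof (cases "x = y")
  case False
  obtain C where C: "\<And>x y. nrm Z (f x - f y) \<le> C * dist x y"
    using f by (auto simp: vecs_Lip0)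
  have "bdd_above {nrm Z (f x - f y) / dist x y | x y. x \<noteq> y}"
    using C by (intro bdd_aboveI[of _ C]) (auto simp: divide_le_eq)
  then have "nrm Z (f x - f y) / dist x y \<le> nrm (Lip0 p Z) f"
    using False by (auto simp: Lip0_def intro!: cSup_upper)
  then show ?thesis using False by (simp add: field_simps)
qed (simp add: nrm_zero[OF Z])

lemma normed_space_Lip0:
  fixes p :: "'m::metric_space"
  assumes Z: "normed_space Z" and two: "\<exists>m :: 'm. m \<noteq> p"
  shows "normed_space (Lip0 p Z)"
proof -
  let ?E = "Lip0 p Z"
  have diff: "f x - f y \<in> vecs Z" if "f \<in> vecs ?E" for f x y
    using that vecs_diff[OF Z] by (auto simp: vecs_Lip0)
  have add_le: "nrm Z ((f + g) x - (f + g) y) \<le> (nrm ?E f + nrm ?E g) * dist x y"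
    if "f \<in> vecs ?E" "g \<in> vecs ?E" for f g x y
  proof -
    have "nrm Z ((f + g) x - (f + g) y) = nrm Z ((f x - f y) + (g x - g y))"
      by (simp add: algebra_simps)
    also have "\<dots> \<le> nrm Z (f x - f y) + nrm Z (g x - g y)"
      using diff that by (intro nrm_add[OF Z])
    also have "\<dots> \<le> (nrm ?E f + nrm ?E g) * dist x y"
      using nrm_diff_le_Lip0[OF Z that(1), of x y] nrm_diff_le_Lip0[OF Z that(2), of x y]
      by (simp add: distrib_right)
    finally show ?thesis .
  qed
  have scale_le: "nrm Z ((c *\<^sub>R f) x - (c *\<^sub>R f) y) \<le> (\<bar>c\<bar> * nrm ?E f) * dist x y"
    if "f \<in> vecs ?E" for c f x y
  proof -
    have "nrm Z ((c *\<^sub>R f) x - (c *\<^sub>R f) y) = \<bar>c\<bar> * nrm Z (f x - f y)"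
      using nrm_scale[OF Z diff[OF that]] by (simp add: scaleR_diff_right[symmetric])
    also have "\<dots> \<le> \<bar>c\<bar> * (nrm ?E f * dist x y)"
      using nrm_diff_le_Lip0[OF Z that] by (intro mult_left_mono) auto
    finally show ?thesis by (simp add: mult.assoc)
  qed
  have sub: "subspace (vecs ?E)"
  proof (rule subspaceI)
    show "0 \<in> vecs ?E" by (auto simp: vecs_Lip0 vecs_zero[OF Z] nrm_zero[OF Z] intro: exI[of _ 0])
  next
    fix f g
    assume fg: "f \<in> vecs ?E" "g \<in> vecs ?E"
    then show "f + g \<in> vecs ?E"
      unfolding vecs_Lip0[of "f + g"] using add_le[OF fg] vecs_add[OF Z] by (auto simp: vecs_Lip0)
  next
    fix c f
    assume f: "f \<in> vecs ?E"
    then show "c *\<^sub>R f \<in> vecs ?E"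
      unfolding vecs_Lip0[of "c *\<^sub>R f"] using scale_le[OF f] vecs_scale[OF Z] by (auto simp: vecs_Lip0)
  qed
  have nonneg: "0 \<le> nrm ?E f" if "f \<in> vecs ?E" for f
  proof -
    obtain m where "m \<noteq> p" using two by blast
    then have "0 < dist m p" by simp
    moreover have "0 \<le> nrm ?E f * dist m p"
      using nrm_diff_le_Lip0[OF Z that, of m p] nrm_nonneg[OF Z diff[OF that], of m p] by linarith
    ultimately show ?thesis by (simp add: zero_le_mult_iff)
  qed
  have scale_le': "nrm ?E (c *\<^sub>R f) \<le> \<bar>c\<bar> * nrm ?E f" if "f \<in> vecs ?E" for c f
    using scale_le[OF that] by (intro nrm_Lip0_le[OF two])
  have scale: "nrm ?E (c *\<^sub>R f) = \<bar>c\<bar> * nrm ?E f" if f: "f \<in> vecs ?E" for c f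
  proof (cases "c = 0")
    case True
    then show ?thesis using scale_le'[OF f, of 0] nonneg[OF subspace_0[OF sub]] by simp
  next
    case False
    then have "nrm ?E f \<le> \<bar>1/c\<bar> * nrm ?E (c *\<^sub>R f)"
      using scale_le'[OF subspace_scale[OF sub f, of c], of "1/c"] by simp
    then show ?thesis
      using False scale_le'[OF f, of c] by (simp add: field_simps)
  qed
  have add: "nrm ?E (f + g) \<le> nrm ?E f + nrm ?E g" if "f \<in> vecs ?E" "g \<in> vecs ?E" for f g
    using add_le[OF that] by (intro nrm_Lip0_le[OF two])
  have zero: "f = 0" if f: "f \<in> vecs ?E" and 0: "nrm ?E f = 0" for f
  proof
    fix x
    have "nrm Z (f x - f p) = 0"
      using nrm_diff_le_Lip0[OF Z f, of x p] nrm_nonneg[OF Z diff[OF f], of x p] 0 by simp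
    then show "f x = 0 x"
      using nrm_eq_0[OF Z diff[OF f], of x p] f by (simp add: vecs_Lip0)
  qed
  show ?thesis
    unfolding normed_space_def
    using sub nonneg zero scale add scale[OF subspace_0[OF sub], of 0] by auto
qed

lemma unit_ball_Lip0:
  fixes p :: "'m::metric_space"
  assumes Z: "normed_space Z" and two: "\<exists>m :: 'm. m \<noteq> p"
  shows "f \<in> unit_ball (Lip0 p Z) \<longleftrightarrow>
    (\<forall>m. f m \<in> vecs Z) \<and> f p = 0 \<and> (\<forall>x y. nrm Z (f x - f y) \<le> dist x y)"
proof
  assume f: "f \<in> unit_ball (Lip0 p Z)"
  have "nrm Z (f x - f y) \<le> dist x y" for x y
    using nrm_diff_le_Lip0[OF Z, of f p x y] f mult_right_mono[of "nrm (Lip0 p Z) f" 1 "dist x y"]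
    by (simp add: unit_ball_def)
  then show "(\<forall>m. f m \<in> vecs Z) \<and> f p = 0 \<and> (\<forall>x y. nrm Z (f x - f y) \<le> dist x y)"
    using f by (simp add: unit_ball_def vecs_Lip0)
next
  assume f: "(\<forall>m. f m \<in> vecs Z) \<and> f p = 0 \<and> (\<forall>x y. nrm Z (f x - f y) \<le> dist x y)"
  then have "f \<in> vecs (Lip0 p Z)" by (auto simp: vecs_Lip0 intro: exI[of _ 1])
  moreover have "nrm (Lip0 p Z) f \<le> 1" using f by (intro nrm_Lip0_le[OF two]) auto
  ultimately show "f \<in> unit_ball (Lip0 p Z)" by (simp add: unit_ball_def)
qed

section \<open>Delta-points against strongly exposed points\<close>

text \<open>A strongly exposing functional cuts off slices of small diameter around the exposed point,
  but a slice containing a \<open>\<Delta>\<close>-point also meets its far set.\<close>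
lemma convex_DLD2P_imp_no_strongly_exposed_point:
  assumes Z: "normed_space Z" and DLD: "convex_DLD2P Z"
  shows "\<not> strongly_exposed_point Z z"
proof
  assume "strongly_exposed_point Z z"
  then obtain \<phi> where z: "z \<in> unit_ball Z" and \<phi>: "\<phi> \<in> vecs (dual Z)"
    and sup: "\<phi> z = (SUP w\<in>unit_ball Z. \<phi> w)"
    and exp: "\<And>s. (\<forall>n. s n \<in> unit_ball Z) \<Longrightarrow> (\<lambda>n. \<phi> (s n)) \<longlonglongrightarrow> \<phi> z \<Longrightarrow>
      (\<lambda>n. nrm Z (s n - z)) \<longlonglongrightarrow> 0"
    unfolding strongly_exposed_point_def by blast
  let ?K = "nrm (dual Z) \<phi>"
  have K: "0 \<le> ?K" using nrm_nonneg[OF normed_space_dual[OF Z] \<phi>] .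
  have ball_vecs: "x \<in> vecs Z" if "x \<in> unit_ball Z" for x
    using that by (simp add: unit_ball_def)
  have le_K: "\<phi> x \<le> ?K" if "x \<in> unit_ball Z" for x
    using abs_le_nrm_dual[OF Z \<phi> ball_vecs[OF that]] mult_left_mono[OF _ K, of "nrm Z x" 1] that
    by (simp add: unit_ball_def)
  have max: "\<phi> x \<le> \<phi> z" if "x \<in> unit_ball Z" for x
    unfolding sup using that le_K by (intro cSUP_upper bdd_aboveI2) auto
  \<comment> \<open>If \<open>S\<close> missed the slice, the complementary half-space would contain
    \<open>convex hull S\<close> and, by continuity of \<open>\<phi>\<close>, its norm
    closure.\<close>
  have slice: "\<exists>s\<in>S. \<phi> z - e < \<phi> s"
    if x: "x \<in> norm_closure Z (convex hull S)" "\<phi> z - e < \<phi> x" and S: "S \<subseteq> unit_ball Z" for x S e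
  proof (rule ccontr)
    assume neg: "\<not> (\<exists>s\<in>S. \<phi> z - e < \<phi> s)"
    have "convex {s \<in> vecs Z. \<phi> s \<le> \<phi> z - e}"
    proof (rule convexI, safe)
      fix s t and a b :: real
      assume st: "s \<in> vecs Z" "t \<in> vecs Z" and le: "\<phi> s \<le> \<phi> z - e" "\<phi> t \<le> \<phi> z - e"
        and ab: "0 \<le> a" "0 \<le> b" "a + b = 1"
      show "a *\<^sub>R s + b *\<^sub>R t \<in> vecs Z" using st vecs_add[OF Z] vecs_scale[OF Z] by blast
      have "\<phi> (a *\<^sub>R s + b *\<^sub>R t) = a * \<phi> s + b * \<phi> t"
        using dual_add[OF \<phi>] dual_scale[OF \<phi>] st vecs_scale[OF Z] by simp
      also have "\<dots> \<le> a * (\<phi> z - e) + b * (\<phi> z - e)"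
        using le ab by (intro add_mono mult_left_mono)
      finally show "\<phi> (a *\<^sub>R s + b *\<^sub>R t) \<le> \<phi> z - e"
        using ab by (simp add: distrib_right[symmetric])
    qed
    then have hull: "convex hull S \<subseteq> {s \<in> vecs Z. \<phi> s \<le> \<phi> z - e}"
      using neg S ball_vecs by (intro hull_minimal) (auto simp: not_less)
    have xv: "x \<in> vecs Z" using x by (simp add: norm_closure_def)
    have "\<phi> x \<le> \<phi> z - e + d" if "0 < d" for d
    proof -
      have "0 < d / (?K + 1)" using that K by (intro divide_pos_pos) auto
      then obtain s where s: "s \<in> convex hull S" "nrm Z (x - s) < d / (?K + 1)"
        using norm_closureD[OF x(1)] by blast
      then have sv: "s \<in> vecs Z" "\<phi> s \<le> \<phi> z - e" using hull by auto
      have "\<phi> x = \<phi> (x - s) + \<phi> s"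
        using dual_add[OF \<phi> vecs_diff[OF Z xv sv(1)] sv(1)] by simp
      moreover have "\<phi> (x - s) \<le> ?K * nrm Z (x - s)"
        using abs_le_nrm_dual[OF Z \<phi> vecs_diff[OF Z xv sv(1)]] by simp
      moreover have "?K * nrm Z (x - s) \<le> (?K + 1) * nrm Z (x - s)"
        using nrm_nonneg[OF Z vecs_diff[OF Z xv sv(1)]] by (intro mult_right_mono) auto
      moreover have "(?K + 1) * nrm Z (x - s) < d"
        using s(2) K by (simp add: field_simps)
      ultimately show ?thesis using sv by linarith
    qed
    then have "\<phi> x \<le> \<phi> z - e" by (rule field_le_epsilon)
    then show False using x(2) by simp
  qed
  \<comment> \<open>The slice contains a \<Delta>-point \<open>w\<close> by the convex DLD2P, and
    then a point \<open>u\<close> of the far set of \<open>w\<close>, since \<open>w\<close> is in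
    the closed convex hull of that set. The parameter 1 of the far set already keeps the two
    apart.\<close>
  have "\<exists>w u. w \<in> unit_ball Z \<and> u \<in> unit_ball Z \<and> 1 \<le> nrm Z (w - u) \<and> \<phi> z - e < \<phi> w \<and> \<phi> z - e < \<phi> u"
    if "0 < e" for e
  proof -
    have "Delta_points Z \<subseteq> unit_ball Z"
      by (auto simp: Delta_points_def unit_sphere_def unit_ball_def)
    moreover have "z \<in> norm_closure Z (convex hull (Delta_points Z))"
      using z DLD by (simp add: convex_DLD2P_def)
    ultimately obtain w where w: "w \<in> Delta_points Z" "\<phi> z - e < \<phi> w" "w \<in> unit_ball Z"
      using slice[of z "Delta_points Z" e] \<open>0 < e\<close> by auto
    then have "w \<in> norm_closure Z (convex hull (far_set Z 1 w))"
      by (auto simp: Delta_points_def)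
    moreover have "far_set Z 1 w \<subseteq> unit_ball Z" by (auto simp: far_set_def)
    ultimately obtain u where "u \<in> far_set Z 1 w" "\<phi> z - e < \<phi> u"
      using slice w(2) by blast
    then show ?thesis using w by (auto simp: far_set_def)
  qed
  then have "\<forall>n. \<exists>w u. w \<in> unit_ball Z \<and> u \<in> unit_ball Z \<and> 1 \<le> nrm Z (w - u) \<and>
      \<phi> z - 1 / real (Suc n) < \<phi> w \<and> \<phi> z - 1 / real (Suc n) < \<phi> u"
    by simp
  then obtain w u where wu: "\<And>n. w n \<in> unit_ball Z" "\<And>n. u n \<in> unit_ball Z"
    "\<And>n. 1 \<le> nrm Z (w n - u n)" "\<And>n. \<phi> z - 1 / real (Suc n) < \<phi> (w n)"
    "\<And>n. \<phi> z - 1 / real (Suc n) < \<phi> (u n)"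
    unfolding choice_iff by blast
  have lim: "(\<lambda>n. \<phi> (s n)) \<longlonglongrightarrow> \<phi> z"
    if "\<And>n. s n \<in> unit_ball Z" "\<And>n. \<phi> z - 1 / real (Suc n) < \<phi> (s n)" for s
  proof (rule tendsto_sandwich)
    show "(\<lambda>n. \<phi> z - 1 / real (Suc n)) \<longlonglongrightarrow> \<phi> z"
      using tendsto_diff[OF tendsto_const LIMSEQ_inverse_real_of_nat, of "\<phi> z"]
      by (simp add: inverse_eq_divide)
    show "(\<lambda>n. \<phi> z) \<longlonglongrightarrow> \<phi> z" by simp
  qed (use that max in \<open>auto intro: less_imp_le always_eventually\<close>)
  \<comment> \<open>Two maximizing sequences would both converge to \<open>z\<close> although they
    stay at distance at least 1 from each other.\<close>
  have "(\<lambda>n. nrm Z (w n - z) + nrm Z (u n - z)) \<longlonglongrightarrow> 0 + 0"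
    using wu by (intro tendsto_add exp lim) auto
  moreover have "1 \<le> nrm Z (w n - z) + nrm Z (u n - z)" for n
    using nrm_triangle[OF Z, of "w n" z "u n"] nrm_diff_commute[OF Z, of z "u n"]
      wu(3)[of n] ball_vecs[OF wu(1)] ball_vecs[OF wu(2)] ball_vecs[OF z] by force
  ultimately have "(1::real) \<le> 0 + 0"
    by (intro LIMSEQ_le_const) auto
  then show False by simp
qed

subsection \<open>Vector-valued Lipschitz-free spaces\<close>

text \<open>The base point and \<open>X\<close> are parameters, so that the same facts serve the
  real line and one-dimensional spaces on another type.\<close>

locale vector_free_space =
  fixes p :: "'m::metric_space" and X :: "'x::real_vector nspace"
  assumes X: "normed_space X" and two: "\<exists>m :: 'm. m \<noteq> p"
begin

abbreviation E where "E \<equiv> Lip0 p (dual X)"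
abbreviation D where "D \<equiv> dual E"
abbreviation F where "F \<equiv> free_space p X"
abbreviation \<delta> where "\<delta> \<equiv> delta p X"

definition deltas where "deltas = {\<delta> m x | m x. x \<in> vecs X}"

text \<open>The molecule of \<open>u\<close> and \<open>w\<close> tensored with \<open>v\<close>. It
  is 0 for \<open>u = w\<close>, as \<open>1 / 0 = 0\<close>.\<close>

definition molecule where "molecule u w v = (1 / dist u w) *\<^sub>R (\<delta> u v - \<delta> w v)"

definition molecules where "molecules = {molecule u w v | u w v. u \<noteq> w \<and> v \<in> unit_sphere X}"

text \<open>Subtracting \<open>g p\<close> admits every 1-Lipschitz \<open>g\<close>, whatever its
  value at the base point; molecules do not see the constant.\<close>

definition tensor :: "('m \<Rightarrow> real) \<Rightarrow> ('x \<Rightarrow> real) \<Rightarrow> 'm \<Rightarrow> 'x \<Rightarrow> real" where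
  "tensor g \<phi> = (\<lambda>m. (g m - g p) *\<^sub>R \<phi>)"

lemmas normed_dual = normed_space_dual[OF X]
lemmas normed_E = normed_space_Lip0[OF normed_dual two]
lemmas normed_D = normed_space_dual[OF normed_E]

lemma vecs_F: "vecs F = norm_closure D (span deltas)"
  and nrm_F: "nrm F = nrm D"
  by (simp_all add: free_space_def deltas_def Let_def)

lemma E_value: "f \<in> vecs E \<Longrightarrow> f m \<in> vecs (dual X)"
  by (simp add: vecs_Lip0)

lemma delta_apply: "f \<in> vecs E \<Longrightarrow> \<delta> m x f = f m x"
  by (simp add: delta_def)

lemma delta_in_D:
  assumes x: "x \<in> vecs X"
  shows "\<delta> m x \<in> vecs D"
proof -
  have "\<bar>f m x\<bar> \<le> (dist m p * nrm X x) * nrm E f" if f: "f \<in> vecs E" for f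
  proof -
    have "\<bar>f m x\<bar> \<le> nrm (dual X) (f m - f p) * nrm X x"
      using abs_le_nrm_dual[OF X E_value[OF f, of m] x] f by (simp add: vecs_Lip0)
    also have "\<dots> \<le> (nrm E f * dist m p) * nrm X x"
      by (intro mult_right_mono nrm_diff_le_Lip0[OF normed_dual f] nrm_nonneg[OF X x])
    finally show ?thesis by (simp add: algebra_simps)
  qed
  then show ?thesis
    unfolding vecs_dual using vecs_add[OF normed_E] vecs_scale[OF normed_E]
    by (auto simp: delta_def)
qed

lemma span_deltas_subset_D: "span deltas \<subseteq> vecs D"
  using delta_in_D by (intro span_minimal subspace_vecs[OF normed_D]) (auto simp: deltas_def)

lemma span_deltas_subset_F: "span deltas \<subseteq> vecs F"
  using span_deltas_subset_D nrm_zero[OF normed_D] by (force simp: vecs_F norm_closure_def)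

lemma F_subset_D: "vecs F \<subseteq> vecs D"
  by (auto simp: vecs_F norm_closure_def)

lemma normed_F: "normed_space F"
  using subspace_norm_closure[OF normed_D subspace_span span_deltas_subset_D] normed_D F_subset_D
  unfolding normed_space_def nrm_F by (simp add: vecs_F subset_iff)

lemma delta_in_F: "x \<in> vecs X \<Longrightarrow> \<delta> m x \<in> vecs F"
  using span_deltas_subset_F by (auto simp: deltas_def intro: span_base)

lemma delta_add: "x \<in> vecs X \<Longrightarrow> y \<in> vecs X \<Longrightarrow> \<delta> m (x + y) = \<delta> m x + \<delta> m y"
  using dual_add[OF E_value] by (auto simp: delta_def)

lemma delta_scale: "x \<in> vecs X \<Longrightarrow> \<delta> m (c *\<^sub>R x) = c *\<^sub>R \<delta> m x"
  using dual_scale[OF E_value] by (auto simp: delta_def)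

lemma delta_base: "\<delta> p x = 0"
  by (auto simp: delta_def vecs_Lip0)

lemma abs_le_nrm_D: "\<mu> \<in> vecs D \<Longrightarrow> f \<in> unit_ball E \<Longrightarrow> \<bar>\<mu> f\<bar> \<le> nrm D \<mu>"
  using abs_le_nrm_dual[OF normed_E, of \<mu> f] nrm_nonneg[OF normed_D, of \<mu>]
    mult_left_mono[of "nrm E f" 1 "nrm D \<mu>"]
  by (simp add: unit_ball_def)

lemmas unit_ball_E = unit_ball_Lip0[OF normed_dual two]

lemma unit_ball_E_diff:
  assumes "f \<in> unit_ball E" "v \<in> vecs X"
  shows "\<bar>f u v - f w v\<bar> \<le> dist u w * nrm X v"
proof -
  have "f u - f w \<in> vecs (dual X)"
    using assms by (intro vecs_diff[OF normed_dual]) (auto simp: unit_ball_E)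
  then have "\<bar>f u v - f w v\<bar> \<le> nrm (dual X) (f u - f w) * nrm X v"
    using abs_le_nrm_dual[OF X _ assms(2), of "f u - f w"] by simp
  also have "\<dots> \<le> dist u w * nrm X v"
    using assms nrm_nonneg[OF X] by (intro mult_right_mono) (auto simp: unit_ball_E)
  finally show ?thesis .
qed

lemma nrm_delta_diff_le:
  assumes "v \<in> vecs X"
  shows "nrm F (\<delta> u v - \<delta> w v) \<le> dist u w * nrm X v"
  unfolding nrm_F using unit_ball_E_diff[OF _ assms]
  by (intro nrm_dual_le[OF normed_E]) (auto simp: delta_apply unit_ball_def)

lemma molecule_in_span: "v \<in> vecs X \<Longrightarrow> molecule u w v \<in> span deltas"
  unfolding molecule_def deltas_def by (intro span_scale span_diff span_base) auto

lemma molecule_in_F: "v \<in> vecs X \<Longrightarrow> molecule u w v \<in> vecs F"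
  using molecule_in_span span_deltas_subset_F by blast

lemma molecule_in_ball:
  assumes "v \<in> unit_sphere X"
  shows "molecule u w v \<in> unit_ball F"
proof -
  have v: "v \<in> vecs X" "nrm X v = 1" using assms by (auto simp: unit_sphere_def)
  have "nrm F (molecule u w v) = 1 / dist u w * nrm F (\<delta> u v - \<delta> w v)"
    unfolding molecule_def
    using nrm_scale[OF normed_F vecs_diff[OF normed_F delta_in_F[OF v(1)] delta_in_F[OF v(1)]]] by simp
  also have "\<dots> \<le> 1 / dist u w * dist u w"
    using nrm_delta_diff_le[OF v(1), of u w] v by (intro mult_left_mono) auto
  also have "\<dots> \<le> 1" by simp
  finally show ?thesis using molecule_in_F[OF v(1)] by (simp add: unit_ball_def)
qed

lemma tensor_in_ball:
  assumes g: "\<And>u w. \<bar>g u - g w\<bar> \<le> dist u w" and \<phi>: "\<phi> \<in> unit_ball (dual X)"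
  shows "tensor g \<phi> \<in> unit_ball E"
proof -
  have \<phi>v: "\<phi> \<in> vecs (dual X)" using \<phi> by (simp add: unit_ball_def)
  have "nrm (dual X) (tensor g \<phi> u - tensor g \<phi> w) \<le> dist u w" for u w
  proof -
    have "nrm (dual X) (tensor g \<phi> u - tensor g \<phi> w) = \<bar>g u - g w\<bar> * nrm (dual X) \<phi>"
      using nrm_scale[OF normed_dual \<phi>v, of "g u - g w"]
      by (simp add: tensor_def scaleR_diff_left[symmetric])
    also have "\<dots> \<le> dist u w * 1"
      using g \<phi> nrm_nonneg[OF normed_dual \<phi>v] by (intro mult_mono) (auto simp: unit_ball_def)
    finally show ?thesis by simp
  qed
  then show ?thesis
    using vecs_scale[OF normed_dual \<phi>v] by (auto simp: unit_ball_E tensor_def)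
qed

lemma molecule_tensor:
  assumes "tensor g \<phi> \<in> unit_ball E"
  shows "molecule u w v (tensor g \<phi>) = (g u - g w) / dist u w * \<phi> v"
  using assms by (simp add: molecule_def delta_apply unit_ball_def)
    (simp add: tensor_def left_diff_distrib[symmetric])

lemma molecule_commute: "- molecule u w v = molecule w u v"
  by (simp add: molecule_def dist_commute scaleR_minus_right[symmetric] del: scaleR_minus_right)

lemma delta_diff_molecule:
  assumes x: "x \<in> vecs X" "x \<noteq> 0" and "u \<noteq> w"
  shows "\<delta> u x - \<delta> w x = (dist u w * nrm X x) *\<^sub>R molecule u w ((1 / nrm X x) *\<^sub>R x)"
    and "(1 / nrm X x) *\<^sub>R x \<in> unit_sphere X"
proof -
  have pos: "0 < nrm X x" using nrm_nonneg[OF X] nrm_eq_0[OF X] x by (simp add: less_le)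
  show "\<delta> u x - \<delta> w x = (dist u w * nrm X x) *\<^sub>R molecule u w ((1 / nrm X x) *\<^sub>R x)"
    using pos \<open>u \<noteq> w\<close> by (simp add: molecule_def delta_scale[OF x(1)] scaleR_diff_right)
  show "(1 / nrm X x) *\<^sub>R x \<in> unit_sphere X"
    using pos vecs_scale[OF X x(1)] nrm_scale[OF X x(1), of "1 / nrm X x"] by (simp add: unit_sphere_def)
qed

text \<open>Serves \<open>hahn_banach_separation\<close>, which separates points of the span of the
  convex set.\<close>

lemma deltas_subset_span_molecules: "deltas \<subseteq> span molecules"
proof
  fix \<mu> assume "\<mu> \<in> deltas"
  then obtain m x where \<mu>: "\<mu> = \<delta> m x" "x \<in> vecs X" by (auto simp: deltas_def)
  consider "x = 0" | "m = p" | "x \<noteq> 0" "m \<noteq> p" by blast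
  then show "\<mu> \<in> span molecules"
  proof cases
    case 1
    then have "\<mu> = 0" using delta_scale[OF \<mu>(2), of m 0] \<mu> by simp
    then show ?thesis by (simp add: span_zero)
  next
    case 2
    then show ?thesis using \<mu> by (simp add: delta_base span_zero)
  next
    case 3
    from delta_diff_molecule[OF \<mu>(2) this]
    have "\<mu> = (dist m p * nrm X x) *\<^sub>R molecule m p ((1 / nrm X x) *\<^sub>R x)"
      "molecule m p ((1 / nrm X x) *\<^sub>R x) \<in> molecules"
      using \<mu> 3 by (auto simp: delta_base molecules_def)
    then show ?thesis by (simp add: span_scale span_base)
  qed
qed

text \<open>A functional separating \<open>\<mu>\<close> from the molecules is evaluation at a Lipschitz map
  of norm at most one.\<close>
lemma in_convex_hull_molecules:
  assumes \<mu>: "\<mu> \<in> span deltas" "nrm F \<mu> < 1" and ne: "unit_sphere X \<noteq> {}"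
  shows "\<mu> \<in> convex hull molecules"
proof (rule ccontr)
  assume neg: "\<mu> \<notin> convex hull molecules"
  have "molecules \<noteq> {}"
    using two ne by (auto simp: molecules_def)
  moreover have "- \<nu> \<in> convex hull molecules" if "\<nu> \<in> convex hull molecules" for \<nu>
  proof -
    have "uminus ` molecules \<subseteq> molecules"
      by (auto simp: molecules_def molecule_commute) metis
    then have "convex hull (uminus ` molecules) \<subseteq> convex hull molecules"
      by (rule hull_mono)
    moreover have "uminus ` (convex hull molecules) = convex hull (uminus ` molecules)"
      by (rule convex_hull_linear_image) (auto intro!: linearI)
    ultimately show ?thesis using that by blast
  qed
  moreover have "\<mu> \<in> span (convex hull molecules)"
  proof -
    have "span deltas \<subseteq> span molecules"
      using deltas_subset_span_molecules by (intro span_minimal) auto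
    also have "\<dots> \<subseteq> span (convex hull molecules)"
      by (intro span_mono hull_subset)
    finally show ?thesis using \<mu> by blast
  qed
  ultimately obtain \<Phi> :: "_ \<Rightarrow> real" where \<Phi>: "linear \<Phi>"
    "\<And>\<nu>. \<nu> \<in> convex hull molecules \<Longrightarrow> \<Phi> \<nu> \<le> 1" "1 \<le> \<Phi> \<mu>"
    using hahn_banach_separation[OF convex_convex_hull, of molecules \<mu>] neg by auto
  \<comment> \<open>The map at which \<open>\<Phi>\<close> is to be an evaluation. The bound 1 of
    \<open>\<Phi>\<close> on molecules makes it 1-Lipschitz into the dual of
    \<open>X\<close>.\<close>
  define f where "f m = (\<lambda>x. if x \<in> vecs X then \<Phi> (\<delta> m x) else 0)" for m
  have le: "\<Phi> (\<delta> u x) - \<Phi> (\<delta> w x) \<le> dist u w * nrm X x" if x: "x \<in> vecs X" for u w x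
  proof (cases "x = 0 \<or> u = w")
    case True
    have "\<delta> u 0 = 0" for u using delta_scale[OF x, of u 0] by simp
    then show ?thesis using True nrm_zero[OF X] by auto
  next
    case False
    then have "molecule u w ((1 / nrm X x) *\<^sub>R x) \<in> convex hull molecules"
      using delta_diff_molecule(2)[OF x, of u w] by (intro hull_inc) (auto simp: molecules_def)
    then have "(dist u w * nrm X x) * \<Phi> (molecule u w ((1 / nrm X x) *\<^sub>R x)) \<le> (dist u w * nrm X x) * 1"
      using nrm_nonneg[OF X x] by (intro mult_left_mono \<Phi>(2)) auto
    then show ?thesis
      using delta_diff_molecule(1)[OF x, of u w] False
      by (simp add: linear_diff[OF \<Phi>(1), symmetric] linear_cmul[OF \<Phi>(1)])
  qed
  have abs_le: "\<bar>f u x - f w x\<bar> \<le> dist u w * nrm X x" if "x \<in> vecs X" for u w x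
    using le[OF that, of u w] le[OF that, of w u] that by (simp add: f_def dist_commute abs_le_iff)
  have f0: "f p = 0"
    by (auto simp: f_def delta_base linear_0[OF \<Phi>(1)])
  have f_dual: "f m \<in> vecs (dual X)" for m
  proof -
    have "\<exists>C. \<forall>x\<in>vecs X. \<bar>f m x\<bar> \<le> C * nrm X x"
      using abs_le[of _ m p] f0 by (intro exI[of _ "dist m p"]) auto
    then show ?thesis
      unfolding vecs_dual
      using vecs_add[OF X] vecs_scale[OF X] linear_add[OF \<Phi>(1)] linear_cmul[OF \<Phi>(1)]
      by (auto simp: f_def delta_add delta_scale)
  qed
  have "f \<in> unit_ball E"
  proof -
    have "nrm (dual X) (f u - f w) \<le> dist u w" for u w
    proof (rule nrm_dual_le[OF X])
      fix x assume "x \<in> unit_ball X"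
      then show "\<bar>(f u - f w) x\<bar> \<le> dist u w"
        using abs_le[of x u w] mult_left_mono[of "nrm X x" 1 "dist u w"] by (simp add: unit_ball_def)
    qed
    then show ?thesis using f_dual f0 by (simp add: unit_ball_E)
  qed
  then have fE: "f \<in> vecs E" and "\<mu> f \<le> nrm D \<mu>"
    using abs_le_nrm_D[of \<mu> f] \<mu>(1) span_deltas_subset_D by (auto simp: unit_ball_def)
  \<comment> \<open>Both sides are linear in \<open>\<nu>\<close> and agree on
    \<open>deltas\<close>. Hence \<open>\<Phi> \<mu>\<close> is at most the norm of
    \<open>\<mu>\<close>, which is below 1.\<close>
  moreover have "\<Phi> \<nu> = \<nu> f" if "\<nu> \<in> span deltas" for \<nu>
    using that
  proof (induction rule: span_induct_alt)
    case base
    show ?case using linear_0[OF \<Phi>(1)] by (simp add: zero_fun_def)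
  next
    case (step c x y)
    have "\<Phi> x = x f"
      using step fE by (auto simp: deltas_def delta_apply) (simp add: f_def)
    then have "c *\<^sub>R \<Phi> x + \<Phi> y = (c *\<^sub>R x + y) f" using step by simp
    then show ?case by (simp only: linear_add[OF \<Phi>(1)] linear_cmul[OF \<Phi>(1)])
  qed
  ultimately show False using \<Phi>(3) \<mu> by (simp add: nrm_F)
qed

lemma unit_ball_F_subset:
  assumes ne: "unit_sphere X \<noteq> {}"
  shows "unit_ball F \<subseteq> norm_closure F (convex hull molecules)"
proof
  fix \<mu> assume \<mu>: "\<mu> \<in> unit_ball F"
  then have \<mu>F: "\<mu> \<in> vecs F" "nrm F \<mu> \<le> 1" by (auto simp: unit_ball_def)
  have "\<exists>s\<in>convex hull molecules. nrm F (\<mu> - s) < e" if "0 < e" for e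
  proof -
    define d where "d = e / 2"
    have d: "0 < d" using that by (simp add: d_def)
    obtain \<nu> where \<nu>: "\<nu> \<in> span deltas" "nrm F (\<mu> - \<nu>) < d"
      using norm_closureD[of \<mu> D "span deltas" d] \<mu>F d by (auto simp: vecs_F nrm_F)
    have \<nu>F: "\<nu> \<in> vecs F" using \<nu> span_deltas_subset_F by blast
    have n\<nu>: "nrm F \<nu> < 1 + d"
      using nrm_le_diff_add[OF normed_F \<nu>F \<mu>F(1)] nrm_diff_commute[OF normed_F \<nu>F \<mu>F(1)] \<mu>F \<nu>
      by linarith
    \<comment> \<open>Scaling brings the norm strictly below 1, as
      \<open>in_convex_hull_molecules\<close> demands, and moves \<open>\<nu>\<close> by at most
      \<open>d\<close>.\<close>
    let ?s = "(1 / (1 + d)) *\<^sub>R \<nu>"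
    have "nrm F ?s < 1"
      using nrm_scale[OF normed_F \<nu>F, of "1 / (1 + d)"] n\<nu> d by simp
    then have s: "?s \<in> convex hull molecules"
      using \<nu>(1) ne by (intro in_convex_hull_molecules span_scale)
    have "nrm F (\<nu> - ?s) = nrm F ((d / (1 + d)) *\<^sub>R \<nu>)"
    proof -
      have "\<nu> - ?s = (1 - 1 / (1 + d)) *\<^sub>R \<nu>" by (simp add: scaleR_diff_left)
      also have "1 - 1 / (1 + d) = d / (1 + d)" using d by (simp add: field_simps)
      finally show ?thesis by (rule arg_cong)
    qed
    also have "\<dots> = d / (1 + d) * nrm F \<nu>"
      using nrm_scale[OF normed_F \<nu>F, of "d / (1 + d)"] d by simp
    also have "\<dots> \<le> d / (1 + d) * (1 + d)"
      using n\<nu> d by (intro mult_left_mono) auto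
    also have "\<dots> = d" using d by simp
    finally have "nrm F (\<mu> - ?s) < e"
      using nrm_triangle[OF normed_F \<mu>F(1) \<nu>F vecs_scale[OF normed_F \<nu>F], of "1 / (1 + d)"] \<nu>(2)
      by (simp add: d_def)
    then show ?thesis using s by blast
  qed
  then show "\<mu> \<in> norm_closure F (convex hull molecules)"
    using \<mu>F by (simp add: norm_closure_def)
qed

end

subsection \<open>Strongly exposed molecules\<close>

lemma mcshane_extension:
  fixes k :: "'m::metric_space \<Rightarrow> real"
  assumes k: "\<And>s t. s \<in> S \<Longrightarrow> t \<in> S \<Longrightarrow> \<bar>k s - k t\<bar> \<le> dist s t" and "S \<noteq> {}"
  shows "\<exists>g. (\<forall>u w. \<bar>g u - g w\<bar> \<le> dist u w) \<and> (\<forall>s\<in>S. g s = k s)"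
proof -
  define g where "g z = (INF s\<in>S. k s + dist z s)" for z
  obtain s0 where s0: "s0 \<in> S" using \<open>S \<noteq> {}\<close> by blast
  have bdd: "bdd_below ((\<lambda>s. k s + dist z s) ` S)" for z
  proof (rule bdd_belowI2[where m = "k s0 - dist z s0"])
    fix s assume "s \<in> S"
    then show "k s0 - dist z s0 \<le> k s + dist z s"
      using k[OF s0, of s] dist_triangle[of s0 s z] by (simp add: dist_commute abs_le_iff)
  qed
  have le: "g z \<le> k s + dist z s" if "s \<in> S" for z s
    unfolding g_def using bdd that by (rule cINF_lower)
  have "g u - g w \<le> dist u w" for u w
  proof -
    have "g u - dist u w \<le> g w"
      unfolding g_def[of w]
    proof (rule cINF_greatest[OF \<open>S \<noteq> {}\<close>])
      fix s assume "s \<in> S"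
      then show "g u - dist u w \<le> k s + dist w s"
        using le[of s u] dist_triangle[of u s w] by linarith
    qed
    then show ?thesis by simp
  qed
  then have "\<bar>g u - g w\<bar> \<le> dist u w" for u w
    by (metis abs_le_iff dist_commute minus_diff_eq)
  moreover have "g s = k s" if "s \<in> S" for s
  proof (rule antisym)
    show "g s \<le> k s" using le[OF that, of s] by simp
    show "k s \<le> g s"
      unfolding g_def
    proof (rule cINF_greatest[OF \<open>S \<noteq> {}\<close>])
      fix t assume "t \<in> S"
      then show "k s \<le> k t + dist s t" using k[OF that, of t] by linarith
    qed
  qed
  ultimately show ?thesis by blast
qed

text \<open>In the use below, \<open>A\<close>, \<open>B\<close> are the distances of
  \<open>u\<close> from \<open>x\<close>, \<open>y\<close>, and \<open>C\<close>, \<open>D\<close>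
  those of \<open>w\<close>, with \<open>d = dist u w\<close>. The numerator
  \<open>B * C - A * D\<close> of the difference equals both
  \<open>C * (B - D) + D * (C - A)\<close> and \<open>B * (C - A) + A * (B - D)\<close>, which gives
  the two bounds.\<close>

lemma weighted_distance_quotient_le:
  fixes a A B C D d :: real
  assumes nonneg: "0 \<le> A" "0 \<le> B" "0 \<le> C" "0 \<le> D" "0 \<le> a" and pos: "0 < A + B" "0 < C + D"
    and le: "C - A \<le> d" "A - C \<le> d" "B - D \<le> d" "D - B \<le> d"
  shows "(a * B / (A + B) - a * D / (C + D)) * (A + B) \<le> a * d"
    and "(a * B / (A + B) - a * D / (C + D)) * (C + D) \<le> a * d"
proof -
  have eq: "a * B / (A + B) - a * D / (C + D) = a * (B * C - A * D) / ((A + B) * (C + D))"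
    using pos by (simp add: field_simps)
  have "B * C - A * D \<le> (C + D) * d"
    using mult_left_mono[OF le(3) nonneg(3)] mult_left_mono[OF le(1) nonneg(4)]
    by (simp add: algebra_simps)
  then have "a * (B * C - A * D) \<le> a * ((C + D) * d)"
    using nonneg by (intro mult_left_mono)
  moreover have "(a * B / (A + B) - a * D / (C + D)) * (A + B) = a * (B * C - A * D) / (C + D)"
    unfolding eq using pos by simp
  ultimately show "(a * B / (A + B) - a * D / (C + D)) * (A + B) \<le> a * d"
    using pos by (simp only: pos_divide_le_eq) (simp add: algebra_simps)
  have "B * C - A * D \<le> (A + B) * d"
    using mult_left_mono[OF le(1) nonneg(2)] mult_left_mono[OF le(3) nonneg(1)]
    by (simp add: algebra_simps)
  then have "a * (B * C - A * D) \<le> a * ((A + B) * d)"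
    using nonneg by (intro mult_left_mono)
  moreover have "(a * B / (A + B) - a * D / (C + D)) * (C + D) = a * (B * C - A * D) / (A + B)"
    unfolding eq using pos by simp
  ultimately show "(a * B / (A + B) - a * D / (C + D)) * (C + D) \<le> a * d"
    using pos by (simp only: pos_divide_le_eq) (simp add: algebra_simps)
qed

text \<open>The average of two functions of Lipschitz constant one that both attain slope one
  between \<open>x\<close> and \<open>y\<close>. A slope close to one of the first, due to Ivakhno, Kadets and Werner, is only
  possible between points near \<open>{x, y}\<close>; the second has slope bounded away from one near \<open>x\<close> and
  near \<open>y\<close>.\<close>
lemma ex_peaking_function:
  fixes x y :: "'m::metric_space"
  assumes "x \<noteq> y" and nZ: "\<not> nearly_between x y"
  obtains h :: "'m \<Rightarrow> real" where "\<And>u w. \<bar>h u - h w\<bar> \<le> dist u w" "h x - h y = dist x y"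
    "\<And>\<eta>. 0 < \<eta> \<Longrightarrow> \<exists>\<alpha>>0. \<forall>u w. u \<noteq> w \<longrightarrow> (1 - \<alpha>) * dist u w \<le> h u - h w \<longrightarrow>
      dist u x \<le> \<eta> \<and> dist w y \<le> \<eta>"
proof -
  define a where "a = dist x y"
  have a: "0 < a" using \<open>x \<noteq> y\<close> by (simp add: a_def)
  obtain \<epsilon>0 where \<epsilon>0: "0 < \<epsilon>0"
    "\<And>z. a + \<epsilon>0 * min (dist x z) (dist z y) \<le> dist x z + dist z y"
    using nZ unfolding nearly_between_def a_def by (auto simp: not_less)
  define \<epsilon> where "\<epsilon> = min 1 \<epsilon>0"
  have \<epsilon>: "0 < \<epsilon>" "\<epsilon> \<le> 1" using \<epsilon>0 by (auto simp: \<epsilon>_def)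
  have gap: "a + \<epsilon> * min (dist x z) (dist z y) \<le> dist x z + dist z y" for z
  proof -
    have "\<epsilon> * min (dist x z) (dist z y) \<le> \<epsilon>0 * min (dist x z) (dist z y)"
      by (intro mult_right_mono) (auto simp: \<epsilon>_def)
    then show ?thesis using \<epsilon>0(2)[of z] by linarith
  qed
  have tri: "a \<le> dist z x + dist z y" for z
    using dist_triangle[of x y z] by (simp add: a_def dist_commute)
  \<comment> \<open>The function of Ivakhno, Kadets and Werner, with value \<open>a\<close> at
    \<open>x\<close> and 0 at \<open>y\<close>. By \<open>f_le\<close> its slope between
    \<open>u\<close> and \<open>w\<close> is at most \<open>a\<close> divided by the sum of the
    distances of either point to \<open>x\<close> and \<open>y\<close>, so a slope near 1 forces
    both sums to be near \<open>a\<close>.\<close>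
  define f where "f z = a * dist z y / (dist z x + dist z y)" for z
  have f_le: "(f u - f w) * (dist u x + dist u y) \<le> a * dist u w"
    "(f u - f w) * (dist w x + dist w y) \<le> a * dist u w" for u w
    unfolding f_def using tri[of u] tri[of w] a
      dist_triangle[of u x w] dist_triangle[of u y w] dist_triangle[of w x u] dist_triangle[of w y u]
    by (intro weighted_distance_quotient_le; simp add: dist_commute)+
  have f_lip': "f u - f w \<le> dist u w" for u w
  proof (rule ccontr)
    assume "\<not> f u - f w \<le> dist u w"
    then have "dist u w * a < (f u - f w) * (dist u x + dist u y)"
      using a tri[of u] by (intro mult_less_le_imp_less) auto
    then show False using f_le(1)[of u w] by (simp add: mult.commute)
  qed
  have f_lip: "\<bar>f u - f w\<bar> \<le> dist u w" for u w
    using f_lip'[of u w] f_lip'[of w u] by (simp add: abs_le_iff dist_commute)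
  have fxy: "f x - f y = a" using a by (simp add: f_def a_def)

  \<comment> \<open>With this radius the balls are disjoint, each of their points is at least as
    near to its own centre as to the other, and \<open>k\<close> is nowhere smaller on the ball
    around \<open>x\<close> than on the one around \<open>y\<close>.\<close>
  define r where "r = a / 4"
  \<comment> \<open>Halving the gap constant shares the gain at one point between the two balls in
    \<open>cross\<close>, and still keeps the slope inside each ball below 1.\<close>
  define c where "c = 1 - \<epsilon> / 2"
  have c: "0 < c" "c < 1" using \<epsilon> by (auto simp: c_def)
  let ?Bx = "cball x r" and ?By = "cball y r"
  define k where "k z = (if dist x z \<le> r then a - c * dist x z else c * dist y z)" for z
  have far: "r < dist x z" if "dist y z \<le> r" for z
    using tri[of z] that a by (simp add: r_def dist_commute)
  have kx: "k z = a - c * dist x z" if "z \<in> ?Bx" for z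
    using that by (simp add: k_def)
  have ky: "k z = c * dist y z" if "z \<in> ?By" for z
    using that far[of z] by (simp add: k_def)
  have slope_x: "\<bar>k z - k w\<bar> \<le> c * dist z w" if "z \<in> ?Bx" "w \<in> ?Bx" for z w
  proof -
    have "\<bar>k z - k w\<bar> = c * \<bar>dist x z - dist x w\<bar>"
      using c kx[OF that(1)] kx[OF that(2)]
      by (simp add: abs_minus_commute right_diff_distrib[symmetric] abs_mult)
    also have "\<dots> \<le> c * dist z w"
      using c dist_triangle[of x z w] dist_triangle[of x w z]
      by (intro mult_left_mono) (auto simp: abs_le_iff dist_commute)
    finally show ?thesis .
  qed
  have slope_y: "\<bar>k z - k w\<bar> \<le> c * dist z w" if "z \<in> ?By" "w \<in> ?By" for z w
  proof -
    have "\<bar>k z - k w\<bar> = c * \<bar>dist y z - dist y w\<bar>"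
      using c ky[OF that(1)] ky[OF that(2)]
      by (simp add: right_diff_distrib[symmetric] abs_mult)
    also have "\<dots> \<le> c * dist z w"
      using c dist_triangle[of y z w] dist_triangle[of y w z]
      by (intro mult_left_mono) (auto simp: abs_le_iff dist_commute)
    finally show ?thesis .
  qed
  have cross: "0 \<le> k z - k w \<and> k z - k w \<le> dist z w" if z: "z \<in> ?Bx" and w: "w \<in> ?By" for z w
  proof -
    have eq: "k z - k w = a - c * (dist x z + dist y w)"
      using kx[OF z] ky[OF w] by (simp add: algebra_simps)
    have "c * (dist x z + dist y w) \<le> 1 * (r + r)"
      using c z w a by (intro mult_mono) (auto simp: r_def)
    then have "0 \<le> k z - k w" using eq a by (simp add: r_def)
    \<comment> \<open>The gap is applied at whichever of \<open>z\<close> and \<open>w\<close> is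
      farther from its own centre.\<close>
    moreover have "a - c * (dist x z + dist y w) \<le> dist z w"
    proof (cases "dist y w \<le> dist x z")
      case True
      have "dist x z \<le> dist z y"
        using tri[of z] z a by (simp add: r_def dist_commute)
      then have "a - (1 - \<epsilon>) * dist x z \<le> dist z y"
        using gap[of z] by (simp add: min_def algebra_simps)
      moreover have "dist z y \<le> dist z w + dist y w"
        using dist_triangle[of z y w] by (simp add: dist_commute)
      moreover have "\<epsilon> * dist y w \<le> \<epsilon> * dist x z" using True \<epsilon> by (intro mult_left_mono) auto
      ultimately show ?thesis by (simp add: c_def algebra_simps)
    next
      case False
      have "dist w y \<le> dist x w"
        using tri[of w] w a by (simp add: r_def dist_commute)
      then have "a - (1 - \<epsilon>) * dist y w \<le> dist x w"
        using gap[of w] by (simp add: min_def algebra_simps dist_commute split: if_splits)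
      moreover have "dist x w \<le> dist x z + dist z w"
        using dist_triangle[of x w z] by simp
      moreover have "\<epsilon> * dist x z \<le> \<epsilon> * dist y w" using False \<epsilon> by (intro mult_left_mono) auto
      ultimately show ?thesis by (simp add: c_def algebra_simps)
    qed
    ultimately show ?thesis using eq by simp
  qed
  have c_le: "c * dist z w \<le> dist z w" for z w :: 'm
    using c mult_right_mono[of c 1 "dist z w"] by simp
  have "\<bar>k z - k w\<bar> \<le> dist z w" if zw: "z \<in> ?Bx \<union> ?By" "w \<in> ?Bx \<union> ?By" for z w
  proof -
    consider "z \<in> ?Bx" "w \<in> ?Bx" | "z \<in> ?By" "w \<in> ?By" | "z \<in> ?Bx" "w \<in> ?By" | "z \<in> ?By" "w \<in> ?Bx"
      using zw by blast
    then show ?thesis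
    proof cases
      case 1 then show ?thesis using slope_x c_le order_trans by blast
    next
      case 2 then show ?thesis using slope_y c_le order_trans by blast
    next
      case 3 then show ?thesis using cross[of z w] by (simp add: abs_le_iff)
    next
      case 4 then show ?thesis using cross[of w z] by (simp add: abs_le_iff dist_commute)
    qed
  qed
  moreover have "?Bx \<union> ?By \<noteq> {}" using a by (auto simp: r_def)
  ultimately obtain g where g_lip: "\<And>u w. \<bar>g u - g w\<bar> \<le> dist u w"
    and gk: "\<And>s. s \<in> ?Bx \<union> ?By \<Longrightarrow> g s = k s"
    using mcshane_extension[of "?Bx \<union> ?By" k] by metis
  have gxy: "g x - g y = a"
  proof -
    have "x \<in> ?Bx" "y \<in> ?By" using a by (auto simp: r_def)
    then show ?thesis using gk kx ky by simp
  qed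
  define h where "h z = (f z + g z) / 2" for z
  show ?thesis
  proof
    show "\<bar>h u - h w\<bar> \<le> dist u w" for u w
      using f_lip[of u w] g_lip[of u w] by (simp add: h_def abs_le_iff field_simps)
    show "h x - h y = dist x y"
      using fxy gxy unfolding h_def a_def by argo
    fix \<eta> :: real assume "0 < \<eta>"
    \<comment> \<open>As \<open>r = a / 4\<close>, the two bounds give
      \<open>4 * \<alpha> * a \<le> \<epsilon> * min \<eta> r\<close>, which puts \<open>u\<close>
      and \<open>w\<close> near the centres. The first also gives
      \<open>c < 1 - 2 * \<alpha>\<close>.\<close>
    define \<alpha> where "\<alpha> = min (\<epsilon> / 16) (\<epsilon> * \<eta> / (4 * a))"
    have \<alpha>: "0 < \<alpha>" "\<alpha> \<le> \<epsilon> / 16" "\<alpha> \<le> \<epsilon> * \<eta> / (4 * a)"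
      using \<epsilon> \<open>0 < \<eta>\<close> a by (auto simp: \<alpha>_def)
    have "dist u x \<le> \<eta> \<and> dist w y \<le> \<eta>"
      if "u \<noteq> w" and slope: "(1 - \<alpha>) * dist u w \<le> h u - h w" for u w
    proof -
      have uw: "0 < dist u w" using that by simp
      \<comment> \<open>Neither \<open>f\<close> nor \<open>g\<close> has slope above 1, so a
        deficit of \<open>\<alpha>\<close> in the average is a deficit of at most
        \<open>2 * \<alpha>\<close> in each.\<close>
      have "2 * ((1 - \<alpha>) * dist u w) \<le> (f u - f w) + (g u - g w)"
        using slope unfolding h_def by argo
      moreover have "(1 - 2 * \<alpha>) * dist u w = 2 * ((1 - \<alpha>) * dist u w) - dist u w"
        by (simp add: algebra_simps)
      ultimately have fs: "(1 - 2 * \<alpha>) * dist u w \<le> f u - f w" and gs: "(1 - 2 * \<alpha>) * dist u w \<le> g u - g w"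
        using f_lip[of u w] g_lip[of u w] unfolding abs_le_iff by argo+
      have near: "min (dist x z) (dist z y) \<le> min \<eta> r"
        if "(f u - f w) * (dist z x + dist z y) \<le> a * dist u w" for z
      proof -
        have "(1 - 2 * \<alpha>) * dist u w * (dist z x + dist z y) \<le> a * dist u w"
          using mult_right_mono[OF fs, of "dist z x + dist z y"] that by simp
        then have "dist u w * ((1 - 2 * \<alpha>) * (dist z x + dist z y)) \<le> dist u w * a"
          by (simp add: algebra_simps)
        then have le: "(1 - 2 * \<alpha>) * (dist z x + dist z y) \<le> a"
          using uw by (simp only: mult_le_cancel_left_pos)
        have "(1 - 2 * \<alpha>) * (a + \<epsilon> * min (dist x z) (dist z y)) \<le> (1 - 2 * \<alpha>) * (dist z x + dist z y)"
          using gap[of z] \<alpha> \<epsilon> by (intro mult_left_mono) (auto simp: dist_commute)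
        then have "(1 - 2 * \<alpha>) * (\<epsilon> * min (dist x z) (dist z y)) \<le> 2 * \<alpha> * a"
          using le by (simp add: algebra_simps)
        moreover have "1/2 * (\<epsilon> * min (dist x z) (dist z y)) \<le> (1 - 2 * \<alpha>) * (\<epsilon> * min (dist x z) (dist z y))"
          using \<alpha> \<epsilon> by (intro mult_right_mono) auto
        ultimately have m: "\<epsilon> * min (dist x z) (dist z y) \<le> 4 * \<alpha> * a" by simp
        have "4 * \<alpha> * a \<le> \<epsilon> * \<eta>" using \<alpha>(3) a by (simp add: field_simps)
        moreover have "4 * \<alpha> * a \<le> \<epsilon> * r" using \<alpha>(2) a by (simp add: r_def)
        ultimately have "\<epsilon> * min (dist x z) (dist z y) \<le> \<epsilon> * \<eta>" "\<epsilon> * min (dist x z) (dist z y) \<le> \<epsilon> * r"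
          using m by linarith+
        then show ?thesis using \<epsilon> by (simp only: mult_le_cancel_left_pos min.bounded_iff)
      qed
      have pos: "0 < (1 - 2 * \<alpha>) * dist u w" using uw \<alpha> \<epsilon> by simp
      have steep: "c * dist u w < (1 - 2 * \<alpha>) * dist u w"
        using uw \<alpha> \<epsilon> by (intro mult_strict_right_mono) (auto simp: c_def)
      have u: "dist x u \<le> min \<eta> r \<or> dist u y \<le> min \<eta> r"
        using near[OF f_le(1)] min_le_iff_disj[of "dist x u" "dist u y" "min \<eta> r"] by blast
      have w: "dist x w \<le> min \<eta> r \<or> dist w y \<le> min \<eta> r"
        using near[OF f_le(2)] min_le_iff_disj[of "dist x w" "dist w y" "min \<eta> r"] by blast
      have bx: "z \<in> ?Bx" if "dist x z \<le> min \<eta> r" for z using that by simp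
      have by': "z \<in> ?By" if "dist z y \<le> min \<eta> r" for z using that by (simp add: dist_commute)
      have gk': "g z = k z" if "z \<in> ?Bx \<or> z \<in> ?By" for z using gk that by blast
      \<comment> \<open>Inside one ball \<open>g\<close> has slope at most \<open>c\<close>, and
        with \<open>u\<close> near \<open>y\<close> and \<open>w\<close> near \<open>x\<close> slope
        at most 0. Both contradict \<open>gs\<close>, leaving \<open>u\<close> near \<open>x\<close>
        and \<open>w\<close> near \<open>y\<close>.\<close>
      have "\<not> (u \<in> ?Bx \<and> w \<in> ?Bx)"
        using slope_x[of u w] gs steep gk'[of u] gk'[of w] by (auto simp: abs_le_iff)
      moreover have "\<not> (u \<in> ?By \<and> w \<in> ?By)"
        using slope_y[of u w] gs steep gk'[of u] gk'[of w] by (auto simp: abs_le_iff)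
      moreover have "\<not> (u \<in> ?By \<and> w \<in> ?Bx)"
        using cross[of w u] gs pos gk'[of u] gk'[of w] by auto
      ultimately have "dist x u \<le> min \<eta> r \<and> dist w y \<le> min \<eta> r"
        using u w bx by' by blast
      then show ?thesis by (simp add: dist_commute)
    qed
    then show "\<exists>\<alpha>>0. \<forall>u w. u \<noteq> w \<longrightarrow> (1 - \<alpha>) * dist u w \<le> h u - h w \<longrightarrow> dist u x \<le> \<eta> \<and> dist w y \<le> \<eta>"
      using \<alpha>(1) by blast
  qed
qed

context vector_free_space
begin

text \<open>On a test function the numerators differ by at most \<open>dist u x + dist w y\<close>.
  Exchanging the denominators costs at most the same again, since \<open>dist u w\<close> and
  \<open>dist x y\<close> differ by no more than this.\<close>

lemma nrm_molecule_diff_le: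
  assumes v: "v \<in> unit_sphere X" and "x \<noteq> y" "u \<noteq> w"
  shows "nrm F (molecule u w v - molecule x y v) \<le> 2 * (dist u x + dist w y) / dist x y"
  unfolding nrm_F
proof (rule nrm_dual_le[OF normed_E])
  fix f assume f: "f \<in> unit_ball E"
  then have fE: "f \<in> vecs E" by (simp add: unit_ball_def)
  let ?a = "dist x y" and ?b = "dist u w" and ?s = "dist u x + dist w y"
  let ?P = "f x v - f y v" and ?Q = "f u v - f w v"
  have diff: "\<bar>f s v - f t v\<bar> \<le> dist s t" for s t
    using unit_ball_E_diff[OF f, of v s t] v by (simp add: unit_sphere_def)
  have pos: "0 < ?a" "0 < ?b" using assms by auto
  have eq: "?Q / ?b - ?P / ?a = ((?Q - ?P) + ?Q / ?b * (?a - ?b)) / ?a"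
    using pos by (simp add: field_simps)
  have "\<bar>?Q - ?P\<bar> \<le> ?s"
    using diff[of u x] diff[of w y] by linarith
  moreover have "\<bar>?Q / ?b * (?a - ?b)\<bar> \<le> 1 * ?s"
    unfolding abs_mult
  proof (rule mult_mono)
    show "\<bar>?Q / ?b\<bar> \<le> 1" using diff[of u w] pos by simp
    show "\<bar>?a - ?b\<bar> \<le> ?s"
      using dist_triangle[of x y u] dist_triangle[of u y w] dist_triangle[of u w x] dist_triangle[of x w y]
      by (simp add: abs_le_iff dist_commute)
  qed auto
  ultimately have "\<bar>?Q - ?P\<bar> + \<bar>?Q / ?b * (?a - ?b)\<bar> \<le> ?s + 1 * ?s" by (rule add_mono)
  then have "\<bar>(?Q - ?P) + ?Q / ?b * (?a - ?b)\<bar> \<le> 2 * ?s"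
    by (intro order_trans[OF abs_triangle_ineq]) simp
  then have "\<bar>?Q / ?b - ?P / ?a\<bar> \<le> 2 * ?s / ?a"
    unfolding eq using pos by (simp add: divide_right_mono)
  then show "\<bar>(molecule u w v - molecule x y v) f\<bar> \<le> 2 * ?s / ?a"
    using fE by (simp add: molecule_def delta_apply)
qed

definition evaluation where "evaluation h = (\<lambda>\<mu>. if \<mu> \<in> vecs F then \<mu> h else 0 :: real)"

lemma evaluation_in_dual:
  assumes h: "h \<in> unit_ball E"
  shows "evaluation h \<in> unit_ball (dual F)"
proof -
  have le: "\<bar>evaluation h \<mu>\<bar> \<le> nrm F \<mu>" if "\<mu> \<in> vecs F" for \<mu>
    using abs_le_nrm_D[OF _ h, of \<mu>] that F_subset_D by (auto simp: evaluation_def nrm_F)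
  then have "evaluation h \<in> vecs (dual F)"
    unfolding vecs_dual using vecs_add[OF normed_F] vecs_scale[OF normed_F]
    by (auto simp: evaluation_def intro!: exI[of _ 1])
  then show ?thesis using le by (simp add: unit_ball_dual[OF normed_F])
qed

text \<open>In dimension one the unit sphere is \<open>{v, - v}\<close>, and the sign is absorbed by
  exchanging the two points.\<close>

lemma one_dim_molecules:
  assumes X1: "vecs X = span {v}" and v: "nrm X v = 1" and \<mu>: "\<mu> \<in> molecules"
  obtains u w where "u \<noteq> w" "\<mu> = molecule u w v"
proof -
  obtain u w v' where *: "\<mu> = molecule u w v'" "u \<noteq> w" "v' \<in> unit_sphere X"
    using \<mu> by (auto simp: molecules_def)
  then obtain c where c: "v' = c *\<^sub>R v"
    using X1 by (auto simp: unit_sphere_def span_singleton)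
  have vX: "v \<in> vecs X" using X1 by (simp add: span_base)
  have "\<bar>c\<bar> = 1" using * c v nrm_scale[OF X vX, of c] by (simp add: unit_sphere_def)
  then have "v' = v \<or> v' = - v" using c by (auto simp: abs_if split: if_splits)
  moreover have "molecule u w (- v) = molecule w u v"
    using delta_scale[OF vX, of _ "- 1"] by (simp add: molecule_def dist_commute)
  ultimately show ?thesis using * that by metis
qed

text \<open>The core is the estimate \<open>key\<close>. A molecule either has slope close to 1 and
  is then within \<open>e\<close> of \<open>?m\<close>, or it loses at least \<open>\<alpha>\<close>
  under \<open>?\<psi>\<close>, and the trivial distance 2 is absorbed by the constant
  \<open>2 / \<alpha>\<close>. The left side is convex in \<open>\<mu>\<close> and the right side
  affine, and both are continuous, so the estimate passes from molecules to the unit ball.\<close>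

lemma molecule_strongly_exposed:
  assumes X1: "vecs X = span {v}" and v: "nrm X v = 1"
    and xy: "x \<noteq> y" "\<not> nearly_between x y"
  shows "strongly_exposed_point F (molecule x y v)"
proof -
  have vX: "v \<in> vecs X" using X1 by (simp add: span_base)
  then have vS: "v \<in> unit_sphere X" using v by (simp add: unit_sphere_def)
  let ?m = "molecule x y v"
  obtain h where h: "\<And>u w. \<bar>h u - h w\<bar> \<le> dist u w" "h x - h y = dist x y"
    "\<And>\<eta>. 0 < \<eta> \<Longrightarrow> \<exists>\<alpha>>0. \<forall>u w. u \<noteq> w \<longrightarrow> (1 - \<alpha>) * dist u w \<le> h u - h w \<longrightarrow>
      dist u x \<le> \<eta> \<and> dist w y \<le> \<eta>"
    using ex_peaking_function[OF xy] by blast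
  obtain \<phi> where \<phi>: "\<phi> \<in> unit_ball (dual X)" "\<phi> v = 1"
    using ex_norming_functional[OF X vX] v by auto
  let ?h = "tensor h \<phi>"
  have hE: "?h \<in> unit_ball E" using h(1) \<phi>(1) by (rule tensor_in_ball)
  let ?\<psi> = "evaluation ?h"
  have \<psi>: "?\<psi> \<in> unit_ball (dual F)" using hE by (rule evaluation_in_dual)
  then have \<psi>v: "?\<psi> \<in> vecs (dual F)" by (simp add: unit_ball_def)
  have mB: "?m \<in> unit_ball F" using vS by (rule molecule_in_ball)
  then have mF: "?m \<in> vecs F" by (simp add: unit_ball_def)
  have val: "?\<psi> (molecule u w v) = (h u - h w) / dist u w" for u w
    using molecule_in_F[OF vX] \<phi>(2) by (simp add: evaluation_def molecule_tensor[OF hE])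
  have \<psi>m: "?\<psi> ?m = 1" using xy h(2) by (simp add: val)
  have \<psi>le: "?\<psi> \<mu> \<le> 1" if "\<mu> \<in> unit_ball F" for \<mu>
  proof -
    have "\<bar>?\<psi> \<mu>\<bar> \<le> nrm F \<mu>" "nrm F \<mu> \<le> 1"
      using \<psi> that by (simp_all add: unit_ball_dual[OF normed_F]) (simp_all add: unit_ball_def)
    then show ?thesis by linarith
  qed
  have sup: "?\<psi> ?m = (SUP \<mu>\<in>unit_ball F. ?\<psi> \<mu>)"
    unfolding \<psi>m
  proof (rule antisym)
    show "1 \<le> (SUP \<mu>\<in>unit_ball F. ?\<psi> \<mu>)"
      using mB \<psi>m \<psi>le by (intro cSUP_upper2[of _ _ ?m] bdd_aboveI2) auto
    show "(SUP \<mu>\<in>unit_ball F. ?\<psi> \<mu>) \<le> 1"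
      using mB \<psi>le by (intro cSUP_least) auto
  qed
  have key: "\<exists>C. \<forall>\<mu>\<in>unit_ball F. nrm F (\<mu> - ?m) \<le> e + C * (1 - ?\<psi> \<mu>)" if e: "0 < e" for e
  proof -
    \<comment> \<open>Chosen so that the bound \<open>2 * (\<eta> + \<eta>) / dist x y\<close> of
      \<open>nrm_molecule_diff_le\<close> equals \<open>e\<close>.\<close>
    define \<eta> where "\<eta> = e * dist x y / 4"
    have "0 < \<eta>" using e xy by (simp add: \<eta>_def)
    then obtain \<alpha> where \<alpha>: "0 < \<alpha>" "\<And>u w. u \<noteq> w \<Longrightarrow> (1 - \<alpha>) * dist u w \<le> h u - h w \<Longrightarrow>
        dist u x \<le> \<eta> \<and> dist w y \<le> \<eta>"
      using h(3) by meson
    let ?G = "{\<mu> \<in> vecs F. nrm F (\<mu> - ?m) \<le> e + 2 / \<alpha> * (1 - ?\<psi> \<mu>)}"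
    have "molecules \<subseteq> ?G"
    proof
      fix \<mu> assume \<mu>: "\<mu> \<in> molecules"
      then obtain u w where uw: "u \<noteq> w" "\<mu> = molecule u w v"
        by (rule one_dim_molecules[OF X1 v])
      have \<mu>B: "\<mu> \<in> unit_ball F" using uw vS molecule_in_ball by simp
      then have \<mu>F: "\<mu> \<in> vecs F" by (simp add: unit_ball_def)
      have "nrm F (\<mu> - ?m) \<le> e + 2 / \<alpha> * (1 - ?\<psi> \<mu>)"
      proof (cases "(1 - \<alpha>) * dist u w \<le> h u - h w")
        case True
        then have "dist u x + dist w y \<le> 2 * \<eta>" using \<alpha>(2)[OF uw(1)] by fastforce
        then have "2 * (dist u x + dist w y) / dist x y \<le> e"
          using xy by (simp add: \<eta>_def divide_le_eq)
        then have "nrm F (\<mu> - ?m) \<le> e"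
          using nrm_molecule_diff_le[OF vS xy(1) uw(1)] uw(2) by simp
        moreover have "0 \<le> 2 / \<alpha> * (1 - ?\<psi> \<mu>)" using \<alpha>(1) \<psi>le[OF \<mu>B] by simp
        ultimately show ?thesis by linarith
      next
        case False
        then have "?\<psi> \<mu> < 1 - \<alpha>" using uw by (simp add: val divide_less_eq)
        then have "2 / \<alpha> * \<alpha> \<le> 2 / \<alpha> * (1 - ?\<psi> \<mu>)"
          using \<alpha>(1) by (intro mult_left_mono) auto
        moreover have "nrm F (\<mu> - ?m) \<le> 2"
        proof -
          have "nrm F (\<mu> - ?m) \<le> nrm F (\<mu> - 0) + nrm F (0 - ?m)"
            by (rule nrm_triangle[OF normed_F \<mu>F vecs_zero[OF normed_F] mF])
          then show ?thesis
            using nrm_minus[OF normed_F mF] \<mu>B mB by (simp add: unit_ball_def)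
        qed
        ultimately show ?thesis using e \<alpha>(1) by simp
      qed
      then show "\<mu> \<in> ?G" using \<mu>F by simp
    qed
    moreover have "convex ?G"
    proof (rule convexI, safe)
      fix \<mu> \<nu> and s t :: real
      assume F: "\<mu> \<in> vecs F" "\<nu> \<in> vecs F" and st: "0 \<le> s" "0 \<le> t" "s + t = 1"
        and le: "nrm F (\<mu> - ?m) \<le> e + 2 / \<alpha> * (1 - ?\<psi> \<mu>)" "nrm F (\<nu> - ?m) \<le> e + 2 / \<alpha> * (1 - ?\<psi> \<nu>)"
      have sF: "s *\<^sub>R \<mu> \<in> vecs F" "t *\<^sub>R \<nu> \<in> vecs F" using F vecs_scale[OF normed_F] by auto
      show "s *\<^sub>R \<mu> + t *\<^sub>R \<nu> \<in> vecs F" using sF vecs_add[OF normed_F] by blast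
      have dF: "\<mu> - ?m \<in> vecs F" "\<nu> - ?m \<in> vecs F" using F mF vecs_diff[OF normed_F] by auto
      have "s *\<^sub>R (\<mu> - ?m) + t *\<^sub>R (\<nu> - ?m) = s *\<^sub>R \<mu> + t *\<^sub>R \<nu> - (s + t) *\<^sub>R ?m"
        by (simp only: scaleR_diff_right scaleR_add_left algebra_simps)
      then have "s *\<^sub>R \<mu> + t *\<^sub>R \<nu> - ?m = s *\<^sub>R (\<mu> - ?m) + t *\<^sub>R (\<nu> - ?m)"
        using st(3) by (simp only: scaleR_one)
      then have "nrm F (s *\<^sub>R \<mu> + t *\<^sub>R \<nu> - ?m) \<le> s * nrm F (\<mu> - ?m) + t * nrm F (\<nu> - ?m)"
        using nrm_add[OF normed_F vecs_scale[OF normed_F dF(1), of s] vecs_scale[OF normed_F dF(2), of t]]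
          nrm_scale[OF normed_F dF(1), of s] nrm_scale[OF normed_F dF(2), of t] st by simp
      also have "\<dots> \<le> s * (e + 2 / \<alpha> * (1 - ?\<psi> \<mu>)) + t * (e + 2 / \<alpha> * (1 - ?\<psi> \<nu>))"
        using le st by (intro add_mono mult_left_mono)
      also have "\<dots> = (s + t) * e + 2 / \<alpha> * ((s + t) - (s * ?\<psi> \<mu> + t * ?\<psi> \<nu>))"
        by (simp add: algebra_simps add_divide_distrib)
      also have "s * ?\<psi> \<mu> + t * ?\<psi> \<nu> = ?\<psi> (s *\<^sub>R \<mu> + t *\<^sub>R \<nu>)"
        using dual_add[OF \<psi>v sF] dual_scale[OF \<psi>v] F by simp
      finally show "nrm F (s *\<^sub>R \<mu> + t *\<^sub>R \<nu> - ?m) \<le> e + 2 / \<alpha> * (1 - ?\<psi> (s *\<^sub>R \<mu> + t *\<^sub>R \<nu>))"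
        unfolding st(3) mult_1 .
    qed
    ultimately have hull: "convex hull molecules \<subseteq> ?G" by (rule hull_minimal)
    have "nrm F (\<mu> - ?m) \<le> e + 2 / \<alpha> * (1 - ?\<psi> \<mu>)" if \<mu>: "\<mu> \<in> unit_ball F" for \<mu>
    proof (rule field_le_epsilon)
      fix d :: real assume d: "0 < d"
      \<comment> \<open>An approximation error \<open>d'\<close> enters once through the norm and
        once through \<open>?\<psi>\<close> with factor \<open>2 / \<alpha>\<close>; the sum is
        \<open>d\<close>.\<close>
      define d' where "d' = d / (1 + 2 / \<alpha>)"
      have d': "0 < d'" using d \<alpha>(1) by (simp add: d'_def add_pos_pos)
      have "unit_sphere X \<noteq> {}" using vS by blast
      then obtain \<nu> where \<nu>: "\<nu> \<in> convex hull molecules" "nrm F (\<mu> - \<nu>) < d'"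
        using unit_ball_F_subset \<mu> norm_closureD[OF _ d'] by blast
      have F: "\<mu> \<in> vecs F" "\<nu> \<in> vecs F" using \<mu> \<nu> hull by (auto simp: unit_ball_def)
      have "?\<psi> \<mu> = ?\<psi> (\<mu> - \<nu>) + ?\<psi> \<nu>"
        using dual_add[OF \<psi>v vecs_diff[OF normed_F F] F(2)] by simp
      moreover have "\<bar>?\<psi> (\<mu> - \<nu>)\<bar> \<le> nrm F (\<mu> - \<nu>)"
        using \<psi> vecs_diff[OF normed_F F] by (simp add: unit_ball_dual[OF normed_F])
      ultimately have "1 - ?\<psi> \<nu> \<le> 1 - ?\<psi> \<mu> + d'" using \<nu>(2) by linarith
      then have "2 / \<alpha> * (1 - ?\<psi> \<nu>) \<le> 2 / \<alpha> * (1 - ?\<psi> \<mu> + d')"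
        using \<alpha>(1) by (intro mult_left_mono) auto
      moreover have "nrm F (\<mu> - ?m) \<le> nrm F (\<mu> - \<nu>) + nrm F (\<nu> - ?m)"
        using nrm_triangle[OF normed_F F mF] .
      moreover have "nrm F (\<nu> - ?m) \<le> e + 2 / \<alpha> * (1 - ?\<psi> \<nu>)" using hull \<nu> by blast
      ultimately have "nrm F (\<mu> - ?m) \<le> e + 2 / \<alpha> * (1 - ?\<psi> \<mu>) + d' * (1 + 2 / \<alpha>)"
        using \<nu>(2) by (simp add: algebra_simps add_divide_distrib)
      moreover have "d' * (1 + 2 / \<alpha>) = d"
      proof -
        have "1 + 2 / \<alpha> \<noteq> 0" using \<alpha>(1) by (simp add: add_pos_pos less_imp_neq[symmetric])
        then show ?thesis by (simp add: d'_def)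
      qed
      ultimately show "nrm F (\<mu> - ?m) \<le> e + 2 / \<alpha> * (1 - ?\<psi> \<mu>) + d" by simp
    qed
    then show ?thesis by blast
  qed
  have conv: "(\<lambda>n. nrm F (s n - ?m)) \<longlonglongrightarrow> 0"
    if s: "\<And>n. s n \<in> unit_ball F" "(\<lambda>n. ?\<psi> (s n)) \<longlonglongrightarrow> ?\<psi> ?m" for s
  proof (rule LIMSEQ_I)
    fix e :: real assume e: "0 < e"
    then obtain C where C: "\<And>\<mu>. \<mu> \<in> unit_ball F \<Longrightarrow> nrm F (\<mu> - ?m) \<le> e/2 + C * (1 - ?\<psi> \<mu>)"
      using key[of "e/2"] by auto
    have "(\<lambda>n. e/2 + C * (1 - ?\<psi> (s n))) \<longlonglongrightarrow> e/2 + C * (1 - 1)"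
      using s(2) unfolding \<psi>m by (intro tendsto_intros)
    then have "eventually (\<lambda>n. e/2 + C * (1 - ?\<psi> (s n)) < e) sequentially"
      by (rule order_tendstoD(2)) (use e in simp)
    then obtain N where N: "\<And>n. N \<le> n \<Longrightarrow> e/2 + C * (1 - ?\<psi> (s n)) < e"
      by (auto simp: eventually_sequentially)
    have "norm (nrm F (s n - ?m) - 0) < e" if "N \<le> n" for n
    proof -
      have "s n - ?m \<in> vecs F" using s(1)[of n] mF vecs_diff[OF normed_F] by (auto simp: unit_ball_def)
      then show ?thesis using C[OF s(1)[of n]] N[OF that] nrm_nonneg[OF normed_F] by fastforce
    qed
    then show "\<exists>N. \<forall>n\<ge>N. norm (nrm F (s n - ?m) - 0) < e" by blast
  qed
  show ?thesis
    unfolding strongly_exposed_point_def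
    using mB \<psi>v sup conv by blast
qed

end

subsection \<open>Molecules as Delta-points\<close>

lemma lipschitz_max:
  fixes f g :: "'m::metric_space \<Rightarrow> real"
  assumes "\<And>u w. f u - f w \<le> K * dist u w" "\<And>u w. g u - g w \<le> K * dist u w"
  shows "max (f u) (g u) - max (f w) (g w) \<le> K * dist u w"
  using assms(1)[of u w] assms(2)[of u w] by (simp add: max_def)

text \<open>Values at \<open>u\<close> and \<open>w\<close> are extended to be as large as possible at \<open>x\<close> and as small as
  possible elsewhere.\<close>
lemma ex_function_reversing_slope:
  fixes x y u w :: "'m::metric_space"
  assumes "1 \<le> K" and near: "dist x u + dist u y \<le> K * dist x y"
  obtains H :: "'m \<Rightarrow> real" where "\<And>s t. \<bar>H s - H t\<bar> \<le> K * dist s t"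
    "H w - H u = dist u w" "dist x y - 2 * dist u w \<le> H x - H y"
proof -
  let ?s = "dist u w"
  \<comment> \<open>With values \<open>- ?s / 2\<close> at \<open>u\<close> and
    \<open>?s / 2\<close> at \<open>w\<close>, \<open>c\<close> is the largest value at
    \<open>x\<close> that a 1-Lipschitz extension allows, and \<open>G\<close> is the smallest such
    extension.\<close>
  define c where "c = min (dist x u - ?s / 2) (dist x w + ?s / 2)"
  define G where "G z = max (- ?s / 2 - dist z u) (?s / 2 - dist z w)" for z
  define H where "H z = max (G z) (c - K * dist z x)" for z
  have dist_le: "dist a b \<le> K * dist a b" for a b :: 'm
    using mult_right_mono[OF \<open>1 \<le> K\<close>, of "dist a b"] by simp
  have shift: "(r - dist a z) - (r - dist b z) \<le> K * dist a b" for r and a b z :: 'm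
    using dist_le[of a b] dist_triangle[of b z a] by (simp add: dist_commute)
  have G: "G a - G b \<le> K * dist a b" for a b
    unfolding G_def by (rule lipschitz_max[OF shift shift])
  have "(c - K * dist a x) - (c - K * dist b x) \<le> K * dist a b" for a b
  proof -
    have "K * dist b x \<le> K * (dist a b + dist a x)"
      using dist_triangle[of b x a] \<open>1 \<le> K\<close> by (intro mult_left_mono) (auto simp: dist_commute)
    then show ?thesis by (simp add: algebra_simps)
  qed
  then have "H a - H b \<le> K * dist a b" for a b
    unfolding H_def by (rule lipschitz_max[OF G])
  then have "\<bar>H a - H b\<bar> \<le> K * dist a b" for a b
    by (metis abs_le_iff dist_commute minus_diff_eq)
  moreover have Hu: "H u = - ?s / 2"
    using dist_le[of u x] by (simp add: H_def G_def c_def max_def min_def dist_commute)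
  moreover have Hw: "H w = ?s / 2"
    using dist_le[of w x] by (simp add: H_def G_def c_def max_def min_def dist_commute)
  moreover have "dist x u - ?s / 2 \<le> H x"
    using dist_triangle[of x u w] by (simp add: H_def c_def dist_commute le_max_iff_disj)
  moreover have "H y \<le> 3 * ?s / 2 - dist u y"
  proof -
    have "G y \<le> 3 * ?s / 2 - dist u y"
      using dist_triangle[of u y w] by (simp add: G_def dist_commute)
    \<comment> \<open>The cone at \<open>x\<close> descends with slope \<open>K\<close> in order to
      lie below \<open>G\<close> at \<open>y\<close>; this is where \<open>near\<close> is
      used.\<close>
    moreover have "c - K * dist y x \<le> G y"
    proof -
      have "c \<le> dist x u - ?s / 2" by (simp add: c_def)
      moreover have "- ?s / 2 - dist u y \<le> G y" by (simp add: G_def dist_commute)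
      ultimately show ?thesis using near dist_commute[of x y] by simp
    qed
    ultimately show ?thesis by (simp add: H_def)
  qed
  moreover have "dist x y \<le> dist x u + dist u y" by (rule dist_triangle)
  ultimately show ?thesis by (intro that[of H]) auto
qed

context vector_free_space
begin

text \<open>The reversing function divided by \<open>K\<close> is 1-Lipschitz. Its slope from
  \<open>u\<close> to \<open>w\<close> contributes \<open>1 / K\<close> to the difference, and its
  slope between \<open>x\<close> and \<open>y\<close> nearly another \<open>1 / K\<close>.\<close>

lemma nrm_molecule_diff_ge:
  assumes v: "v \<in> unit_sphere X" and "x \<noteq> y" "u \<noteq> w" "1 \<le> K"
    and near: "dist x u + dist u y \<le> K * dist x y"
  shows "(2 - 2 * dist u w / dist x y) / K \<le> nrm F (molecule x y v - molecule u w v)"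
proof -
  have vX: "v \<in> vecs X" "nrm X v = 1" using v by (auto simp: unit_sphere_def)
  obtain H where H: "\<And>s t. \<bar>H s - H t\<bar> \<le> K * dist s t" "H w - H u = dist u w"
    "dist x y - 2 * dist u w \<le> H x - H y"
    using ex_function_reversing_slope[OF \<open>1 \<le> K\<close> near, of w] by blast
  obtain \<phi> where \<phi>: "\<phi> \<in> unit_ball (dual X)" "\<phi> v = 1"
    using ex_norming_functional[OF X vX(1)] vX(2) by auto
  define g where "g z = H z / K" for z
  have "\<bar>g s - g t\<bar> \<le> dist s t" for s t
    using H(1)[of s t] \<open>1 \<le> K\<close>
    by (simp add: g_def diff_divide_distrib[symmetric] divide_le_eq mult.commute)
  then have g: "tensor g \<phi> \<in> unit_ball E"
    using \<phi>(1) by (rule tensor_in_ball)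
  have "(molecule x y v - molecule u w v) (tensor g \<phi>) =
      (H x - H y) / K / dist x y - (H u - H w) / K / dist u w"
    using \<phi>(2) molecule_tensor[OF g] by (simp add: g_def diff_divide_distrib)
  also have "\<dots> = ((H x - H y) / dist x y + 1) / K"
    using H(2) \<open>x \<noteq> y\<close> \<open>u \<noteq> w\<close> \<open>1 \<le> K\<close> by (simp add: field_simps)
  finally have eq: "(molecule x y v - molecule u w v) (tensor g \<phi>) = ((H x - H y) / dist x y + 1) / K" .
  have "2 - 2 * dist u w / dist x y = (dist x y - 2 * dist u w) / dist x y + 1"
    using \<open>x \<noteq> y\<close> by (simp add: diff_divide_distrib)
  also have "\<dots> \<le> (H x - H y) / dist x y + 1"
    using H(3) by (simp add: divide_right_mono)
  finally have "(2 - 2 * dist u w / dist x y) / K \<le> ((H x - H y) / dist x y + 1) / K"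
    using \<open>1 \<le> K\<close> by (simp add: divide_right_mono)
  moreover have "molecule x y v - molecule u w v \<in> vecs D"
    using vecs_diff[OF normed_F molecule_in_F[OF vX(1)] molecule_in_F[OF vX(1)]] F_subset_D by blast
  then have "\<bar>(molecule x y v - molecule u w v) (tensor g \<phi>)\<bar> \<le> nrm F (molecule x y v - molecule u w v)"
    unfolding nrm_F using g by (rule abs_le_nrm_D)
  ultimately show ?thesis using eq by linarith
qed

lemma nrm_molecule:
  assumes v: "v \<in> unit_sphere X" and "x \<noteq> y"
  shows "nrm F (molecule x y v) = 1"
proof (rule antisym)
  show "nrm F (molecule x y v) \<le> 1"
    using molecule_in_ball[OF v] by (simp add: unit_ball_def)
  have vX: "v \<in> vecs X" "nrm X v = 1" using v by (auto simp: unit_sphere_def)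
  obtain \<phi> where \<phi>: "\<phi> \<in> unit_ball (dual X)" "\<phi> v = 1"
    using ex_norming_functional[OF X vX(1)] vX(2) by auto
  have "\<bar>dist s y - dist t y\<bar> \<le> dist s t" for s t
    using dist_triangle[of s y t] dist_triangle[of t y s] by (simp add: abs_le_iff dist_commute)
  then have g: "tensor (\<lambda>z. dist z y) \<phi> \<in> unit_ball E"
    using \<phi>(1) by (rule tensor_in_ball)
  have "molecule x y v (tensor (\<lambda>z. dist z y) \<phi>) = 1"
    using molecule_tensor[OF g] \<phi>(2) \<open>x \<noteq> y\<close> by simp
  then show "1 \<le> nrm F (molecule x y v)"
    using abs_le_nrm_D[OF _ g, of "molecule x y v"] molecule_in_F[OF vX(1)] F_subset_D
    by (force simp: nrm_F)
qed

text \<open>Telescoping along the chain gives a convex combination of molecules weighted by step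
  lengths. In the induction \<open>s\<close> bounds the distance from \<open>x\<close> to the
  current start, and \<open>s + t \<le> b\<close> keeps all steps in the region covered by
  \<open>far\<close>. The case \<open>t = 0\<close>, where no weights exist, is separate.\<close>

lemma delta_diff_in_cone:
  assumes "chain d u y t" and far: "\<And>u w. u \<noteq> w \<Longrightarrow> dist u w \<le> d \<Longrightarrow>
      dist x u + dist u y \<le> b \<Longrightarrow> molecule u w v \<in> S"
    and "dist x u \<le> s" "s + t \<le> b"
  shows "(t = 0 \<and> \<delta> u v - \<delta> y v = 0) \<or> (0 < t \<and> (\<exists>k\<in>convex hull S. \<delta> u v - \<delta> y v = t *\<^sub>R k))"
  using assms
proof (induction arbitrary: s rule: chain.induct)
  case (stop y)
  then show ?case by simp
next
  case (step u u' y t)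
  have far: "\<And>u w. u \<noteq> w \<Longrightarrow> dist u w \<le> d \<Longrightarrow> dist x u + dist u y \<le> b \<Longrightarrow> molecule u w v \<in> S"
    by fact
  have "dist x u' \<le> s + dist u u'" "s + dist u u' + t \<le> b"
    using dist_triangle[of x u' u] step.prems by auto
  from step.IH[OF far this]
  have IH: "(t = 0 \<and> \<delta> u' v - \<delta> y v = 0) \<or> (0 < t \<and> (\<exists>k\<in>convex hull S. \<delta> u' v - \<delta> y v = t *\<^sub>R k))" .
  show ?case
  proof (cases "u = u'")
    case True
    show ?thesis using IH unfolding True dist_self add_0_left .
  next
    case False
    let ?r = "dist u u'" and ?m = "molecule u u' v"
    have r: "0 < ?r" using False by simp
    have "dist u y \<le> ?r + t"
      using dist_triangle[of u y u'] dist_le_chain[OF step.hyps(2)] by linarith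
    then have m: "?m \<in> S" using far[OF False step.hyps(1)] step.prems by linarith
    have rm: "\<delta> u v - \<delta> u' v = ?r *\<^sub>R ?m" using r by (simp add: molecule_def)
    have split: "\<delta> u v - \<delta> y v = (\<delta> u v - \<delta> u' v) + (\<delta> u' v - \<delta> y v)" by simp
    from IH show ?thesis
    proof
      assume t: "t = 0 \<and> \<delta> u' v - \<delta> y v = 0"
      then have "\<delta> u v - \<delta> y v = (?r + t) *\<^sub>R ?m" unfolding split rm by (simp only: add_0_right)
      then show ?thesis using t r hull_inc[OF m] by (intro disjI2 conjI bexI[of _ ?m]) auto
    next
      assume "0 < t \<and> (\<exists>k\<in>convex hull S. \<delta> u' v - \<delta> y v = t *\<^sub>R k)"
      then obtain k where t: "0 < t" and k: "k \<in> convex hull S" "\<delta> u' v - \<delta> y v = t *\<^sub>R k" by blast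
      let ?k = "(?r / (?r + t)) *\<^sub>R ?m + (t / (?r + t)) *\<^sub>R k"
      have rt: "0 < ?r + t" using r t by (rule add_pos_pos)
      have "?k \<in> convex hull S"
        using r t rt by (intro convexD[OF convex_convex_hull hull_inc[OF m] k(1)])
          (auto simp: add_divide_distrib[symmetric])
      moreover have "(?r + t) *\<^sub>R ?k = ?r *\<^sub>R ?m + t *\<^sub>R k"
        using rt by (simp add: scaleR_add_right less_imp_neq[symmetric] del: plus_fun_apply)
      then have "\<delta> u v - \<delta> y v = (?r + t) *\<^sub>R ?k" unfolding split rm k(2) by (rule sym)
      ultimately show ?thesis using rt by blast
    qed
  qed
qed

lemma molecule_Delta_point:
  assumes chains: "\<And>(x::'m) y d \<eta>. 0 < d \<Longrightarrow> 0 < \<eta> \<Longrightarrow> \<exists>t. t \<le> (1 + \<eta>) * dist x y \<and> chain d x y t"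
    and v: "v \<in> unit_sphere X" and "x \<noteq> y"
  shows "molecule x y v \<in> Delta_points F"
proof -
  have vX: "v \<in> vecs X" "nrm X v = 1" using v by (auto simp: unit_sphere_def)
  let ?m = "molecule x y v" and ?a = "dist x y"
  have a: "0 < ?a" using \<open>x \<noteq> y\<close> by simp
  have mF: "?m \<in> vecs F" using molecule_in_F[OF vX(1)] .
  have "?m \<in> norm_closure F (convex hull (far_set F \<epsilon> ?m))" if \<epsilon>: "0 < \<epsilon>" for \<epsilon>
  proof -
    let ?S = "far_set F \<epsilon> ?m"
    \<comment> \<open>With mesh \<open>d\<close> and \<open>K = 1 + \<epsilon> / 4\<close>, the
      bound of \<open>nrm_molecule_diff_ge\<close> is at least
      \<open>(2 - \<epsilon> / 4) / K\<close>, which is at least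
      \<open>2 - \<epsilon>\<close>.\<close>
    define d where "d = ?a * \<epsilon> / 8"
    have d: "0 < d" using a \<epsilon> by (simp add: d_def)
    have far: "molecule u w v \<in> ?S"
      if "u \<noteq> w" "dist u w \<le> d" "dist x u + dist u y \<le> (1 + \<epsilon> / 4) * ?a" for u w
    proof -
      have "2 * dist u w / ?a \<le> \<epsilon> / 4"
        using that(2) a by (simp add: d_def divide_le_eq mult.commute)
      moreover have "(2 - \<epsilon>) * (1 + \<epsilon> / 4) \<le> 2 - \<epsilon> / 4"
        using \<epsilon> by (simp add: algebra_simps)
      ultimately have "(2 - \<epsilon>) * (1 + \<epsilon> / 4) \<le> 2 - 2 * dist u w / ?a" by linarith
      then have "2 - \<epsilon> \<le> (2 - 2 * dist u w / ?a) / (1 + \<epsilon> / 4)"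
        using \<epsilon> by (simp only: pos_le_divide_eq)
      also have "\<dots> \<le> nrm F (?m - molecule u w v)"
        using nrm_molecule_diff_ge[OF v \<open>x \<noteq> y\<close> that(1) _ that(3)] \<epsilon> by simp
      finally show ?thesis using molecule_in_ball[OF v] by (simp add: far_set_def)
    qed
    have "\<exists>k\<in>convex hull ?S. nrm F (?m - k) < e" if e: "0 < e" for e
    proof -
      \<comment> \<open>The first bound keeps the chain where \<open>far\<close> applies; the second
        makes the relative excess length of the chain, which bounds the approximation error, smaller
        than \<open>e\<close>.\<close>
      define \<eta> where "\<eta> = min (\<epsilon> / 4) (e / 2)"
      have \<eta>: "0 < \<eta>" "\<eta> \<le> \<epsilon> / 4" "\<eta> < e" using \<epsilon> e by (auto simp: \<eta>_def min_less_iff_disj)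
      obtain t where t: "t \<le> (1 + \<eta>) * ?a" "chain d x y t"
        using chains[OF d \<eta>(1)] by blast
      have "(1 + \<eta>) * ?a \<le> (1 + \<epsilon> / 4) * ?a"
        using \<eta> by (intro mult_right_mono) auto
      then have tb: "0 + t \<le> (1 + \<epsilon> / 4) * ?a" using t by linarith
      have at: "?a \<le> t" using dist_le_chain[OF t(2)] .
      then obtain k where k: "k \<in> convex hull ?S" "\<delta> x v - \<delta> y v = t *\<^sub>R k"
        using delta_diff_in_cone[OF t(2) far _ tb] a by fastforce
      have "convex hull ?S \<subseteq> unit_ball F"
        by (rule hull_minimal) (auto simp: far_set_def convex_unit_ball[OF normed_F])
      then have kF: "k \<in> vecs F" "nrm F k \<le> 1" using k by (auto simp: unit_ball_def)
      have "?m - k = ((t - ?a) / ?a) *\<^sub>R k"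
      proof -
        have "?m - k = (t / ?a) *\<^sub>R k - 1 *\<^sub>R k" by (simp add: molecule_def k(2))
        also have "\<dots> = (t / ?a - 1) *\<^sub>R k" by (rule scaleR_diff_left[symmetric])
        also have "t / ?a - 1 = (t - ?a) / ?a" using a by (simp add: diff_divide_distrib)
        finally show ?thesis .
      qed
      then have "nrm F (?m - k) = (t - ?a) / ?a * nrm F k"
        using nrm_scale[OF normed_F kF(1)] at a by simp
      also have "\<dots> \<le> (t - ?a) / ?a * 1"
        using kF at a by (intro mult_left_mono) auto
      also have "\<dots> \<le> \<eta>" using t(1) a by (simp add: divide_le_eq algebra_simps)
      finally show ?thesis using k(1) \<eta>(3) by (intro bexI[of _ k]) auto
    qed
    then show ?thesis using mF by (simp add: norm_closure_def)
  qed
  then show ?thesis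
    using mF nrm_molecule[OF v \<open>x \<noteq> y\<close>] by (simp add: Delta_points_def unit_sphere_def)
qed

lemma convex_DLD2P_free_space:
  assumes chains: "\<And>(x::'m) y d \<eta>. 0 < d \<Longrightarrow> 0 < \<eta> \<Longrightarrow> \<exists>t. t \<le> (1 + \<eta>) * dist x y \<and> chain d x y t"
    and ne: "unit_sphere X \<noteq> {}"
  shows "convex_DLD2P F"
proof -
  have "molecules \<subseteq> Delta_points F"
    using molecule_Delta_point[OF chains] by (auto simp: molecules_def)
  then have "convex hull molecules \<subseteq> convex hull (Delta_points F)"
    by (rule hull_mono)
  then have "norm_closure F (convex hull molecules) \<subseteq> norm_closure F (convex hull (Delta_points F))"
    by (auto simp: norm_closure_def) blast
  then have "unit_ball F \<subseteq> norm_closure F (convex hull (Delta_points F))"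
    using unit_ball_F_subset[OF ne] by blast
  moreover have "convex hull (Delta_points F) \<subseteq> unit_ball F"
  proof (rule hull_minimal)
    show "Delta_points F \<subseteq> unit_ball F"
      by (auto simp: Delta_points_def unit_sphere_def unit_ball_def)
  qed (rule convex_unit_ball[OF normed_F])
  then have "norm_closure F (convex hull (Delta_points F)) \<subseteq> unit_ball F"
    by (rule norm_closure_subset_unit_ball[OF normed_F])
  ultimately show ?thesis by (simp add: convex_DLD2P_def)
qed

lemma nearly_between_if_no_strongly_exposed_point:
  fixes x y :: 'm
  assumes "vecs X = span {v}" "nrm X v = 1" "x \<noteq> y" "\<nexists>z. strongly_exposed_point F z"
  shows "nearly_between x y"
  using molecule_strongly_exposed[OF assms(1-3)] assms(4) by blast

end

section \<open>One-dimensional spaces and the equivalence\<close>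

lemma nontrivial_unit_sphere:
  assumes X: "normed_space X" and "nontrivial X"
  shows "unit_sphere X \<noteq> {}"
proof -
  obtain x where x: "x \<in> vecs X" "x \<noteq> 0"
    using assms vecs_zero[OF X] by (auto simp: nontrivial_def)
  then have "0 < nrm X x" using nrm_nonneg[OF X] nrm_eq_0[OF X] by (simp add: less_le)
  then have "(1 / nrm X x) *\<^sub>R x \<in> unit_sphere X"
    using x vecs_scale[OF X] nrm_scale[OF X x(1)] by (simp add: unit_sphere_def)
  then show ?thesis by blast
qed

lemma ex_one_dim_banach_space:
  fixes v :: "'x::real_vector"
  assumes "v \<noteq> 0"
  obtains X where "banach_space X" "nontrivial X" "vecs X = span {v}" "nrm X v = 1"
proof -
  \<comment> \<open>Its value is meaningful only on the line through \<open>v\<close>, which is the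
    carrier of \<open>X\<close>.\<close>
  define coord where "coord x = (THE c. x = c *\<^sub>R v)" for x
  have coord: "coord (c *\<^sub>R v) = c" for c
    unfolding coord_def using assms by (intro the_equality) auto
  define X where "X = \<lparr>vecs = span {v}, nrm = (\<lambda>x. \<bar>coord x\<bar>)\<rparr>"
  have rep: "x \<in> vecs X \<longleftrightarrow> (\<exists>c. x = c *\<^sub>R v)" for x
    by (auto simp: X_def span_singleton)
  have nrm: "nrm X (c *\<^sub>R v) = \<bar>c\<bar>" for c
    by (simp add: X_def coord)
  have nrm_add: "nrm X (c *\<^sub>R v + c' *\<^sub>R v) = \<bar>c + c'\<bar>" for c c'
    using nrm[of "c + c'"] by (simp add: scaleR_add_left)
  have nrm_diff: "nrm X (c *\<^sub>R v - c' *\<^sub>R v) = \<bar>c - c'\<bar>" for c c'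
    using nrm[of "c - c'"] by (simp add: scaleR_diff_left)
  have "normed_space X"
    unfolding normed_space_def
  proof (intro conjI ballI allI)
    show "subspace (vecs X)" by (simp add: X_def)
    fix x assume "x \<in> vecs X"
    then obtain c where c: "x = c *\<^sub>R v" by (auto simp: rep)
    show "0 \<le> nrm X x" "(nrm X x = 0) = (x = 0)"
      using assms by (auto simp: c nrm)
    show "nrm X (b *\<^sub>R x) = \<bar>b\<bar> * nrm X x" for b
      using nrm[of "b * c"] by (simp add: c nrm abs_mult)
    fix y assume "y \<in> vecs X"
    then obtain c' where c': "y = c' *\<^sub>R v" by (auto simp: rep)
    show "nrm X (x + y) \<le> nrm X x + nrm X y"
      by (simp add: c c' nrm nrm_add)
  qed
  moreover have "\<exists>l\<in>vecs X. (\<lambda>n. nrm X (s n - l)) \<longlonglongrightarrow> 0"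
    if s: "\<forall>n. s n \<in> vecs X" and Cauchy: "\<forall>e>0. \<exists>N. \<forall>m\<ge>N. \<forall>n\<ge>N. nrm X (s m - s n) < e" for s
  proof -
    obtain c where c: "\<And>n. s n = c n *\<^sub>R v" using s unfolding rep choice_iff by blast
    have "Cauchy c" using Cauchy by (simp add: Cauchy_def c nrm_diff dist_real_def)
    then obtain l where "c \<longlonglongrightarrow> l" by (meson Cauchy_convergent_iff convergent_def)
    then have "(\<lambda>n. \<bar>c n - l\<bar>) \<longlonglongrightarrow> 0"
      using LIM_zero tendsto_rabs_zero by blast
    then show ?thesis by (intro bexI[of _ "l *\<^sub>R v"]) (auto simp: c nrm_diff rep)
  qed
  ultimately have "banach_space X" by (simp add: banach_space_def)
  moreover have "v \<in> vecs X" by (simp add: X_def span_base)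
  then have "nontrivial X" using assms by (auto simp: nontrivial_def)
  moreover have "vecs X = span {v}" by (simp add: X_def)
  moreover have "nrm X v = 1" using nrm[of 1] by simp
  ultimately show ?thesis by (rule that)
qed

lemma convex_DLD2P_free_space_if_nearly_between:
  fixes p :: "'m::complete_space"
  assumes "\<exists>m :: 'm. m \<noteq> p" and Z: "\<And>u v :: 'm. u \<noteq> v \<Longrightarrow> nearly_between u v"
    and X: "normed_space X" "nontrivial X"
  shows "convex_DLD2P (free_space p X)"
proof -
  interpret vector_free_space p X using assms(1) X(1) by unfold_locales
  show ?thesis
    using nearly_between_imp_chain[OF Z] nontrivial_unit_sphere[OF assms(3,4)]
    by (rule convex_DLD2P_free_space)
qed

theorem corollary5p5:
  fixes p :: "'m::complete_space"
  assumes "\<exists>m :: 'm. m \<noteq> p"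
    and "\<exists>v :: 'x::real_vector. v \<noteq> 0"
  shows "((\<nexists>z. strongly_exposed_point (scalar_free_space p) z) \<longleftrightarrow>
            convex_DLD2P (scalar_free_space p)) \<and>
         (convex_DLD2P (scalar_free_space p) \<longleftrightarrow>
            (\<forall>X :: 'x nspace. banach_space X \<and> nontrivial X \<longrightarrow> convex_DLD2P (free_space p X)))"
proof -
  let ?R = "space_of_type :: real nspace"
  have R: "normed_space ?R"
    using banach_space_of_type[where 'a = real] by (simp add: banach_space_def)
  then interpret scalar: vector_free_space p ?R
    using assms(1) by unfold_locales
  have R1: "vecs ?R = span {1}" "nrm ?R 1 = 1"
    by (auto simp: space_of_type_def span_singleton)
  have "nontrivial ?R" by (auto simp: nontrivial_def space_of_type_def)
  have i_Z: "nearly_between u w"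
    if "\<nexists>z. strongly_exposed_point (scalar_free_space p) z" "u \<noteq> w" for u w :: 'm
    using scalar.nearly_between_if_no_strongly_exposed_point[OF R1] that
    by (simp add: scalar_free_space_def)
  have Z_ii: "convex_DLD2P (scalar_free_space p)"
    if "\<And>u w :: 'm. u \<noteq> w \<Longrightarrow> nearly_between u w"
    unfolding scalar_free_space_def
    using assms(1) that R \<open>nontrivial ?R\<close> by (rule convex_DLD2P_free_space_if_nearly_between)
  have ii_i: "\<nexists>z. strongly_exposed_point (scalar_free_space p) z"
    if "convex_DLD2P (scalar_free_space p)"
    using convex_DLD2P_imp_no_strongly_exposed_point[OF scalar.normed_F] that
    by (simp add: scalar_free_space_def)
  \<comment> \<open>The quantifier in (iii) ranges over spaces on \<open>'x\<close>, so it is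
    instantiated with a line in \<open>'x\<close> in place of the reals; (Z) then brings the
    information back to the scalar space.\<close>
  have iii_Z: "nearly_between u w"
    if iii: "\<forall>X :: 'x nspace. banach_space X \<and> nontrivial X \<longrightarrow> convex_DLD2P (free_space p X)"
      and "u \<noteq> w" for u w :: 'm
  proof -
    obtain v :: 'x where "v \<noteq> 0" using assms(2) by blast
    then obtain X :: "'x nspace" where RX: "banach_space X" "nontrivial X" "vecs X = span {v}" "nrm X v = 1"
      by (rule ex_one_dim_banach_space)
    then have "normed_space X" by (simp add: banach_space_def)
    then interpret vector_free_space p X using assms(1) by unfold_locales
    have "convex_DLD2P F" using iii RX by blast
    then have "\<nexists>z. strongly_exposed_point F z"
      using convex_DLD2P_imp_no_strongly_exposed_point[OF normed_F] by blast
    then show ?thesis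
      using nearly_between_if_no_strongly_exposed_point[OF RX(3,4)] \<open>u \<noteq> w\<close> by blast
  qed
  show ?thesis
  proof (intro conjI iffI allI impI)
    assume "\<nexists>z. strongly_exposed_point (scalar_free_space p) z"
    then show "convex_DLD2P (scalar_free_space p)" using Z_ii i_Z by blast
  next
    assume "convex_DLD2P (scalar_free_space p)"
    then show "\<nexists>z. strongly_exposed_point (scalar_free_space p) z" by (rule ii_i)
  next
    fix X :: "'x nspace"
    assume DLD: "convex_DLD2P (scalar_free_space p)" and "banach_space X \<and> nontrivial X"
    then have "normed_space X" "nontrivial X" by (auto simp: banach_space_def)
    with assms(1) i_Z[OF ii_i[OF DLD]] show "convex_DLD2P (free_space p X)"
      by (rule convex_DLD2P_free_space_if_nearly_between)
  next
    assume "\<forall>X :: 'x nspace. banach_space X \<and> nontrivial X \<longrightarrow> convex_DLD2P (free_space p X)"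
    then show "convex_DLD2P (scalar_free_space p)" by (intro Z_ii iii_Z)
  qed
qed

end
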